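(* Let $S$ be a non-densely defined closed symmetric operator in $\mathcal H$ such that $\dim(\operatorname{dom}S)^\perp=\infty$ and $S$ is regular. Let $\widetilde S_0=S_0$ or let $\widetilde S_0$ be a closed symmetric extension of $S_0$ in $\mathcal H_0$. Then there exists a selfadjoint extension $\widetilde S$ of $S$ in $\mathcal H$ whose compression $P_{\mathcal H_0}\widetilde S\upharpoonright(\operatorname{dom}\widetilde S\cap\mathcal H_0)$ coincides with $\widetilde S_0$.
   Context: $\mathcal H$ is an infinite-dimensional complex separable Hilbert space. $S$ is symmetric if $\operatorname{Im}(Sf,f)=0$ for all $f\in\operatorname{dom}S$ (domain not necessarily dense). $\mathcal H_0=\overline{\operatorname{dom}}\,S$, $P_{\mathcal H_0}$ is the orthogonal projection onto $\mathcal H_0$, and $S_0=P_{\mathcal H_0}S$, regarded as a densely defined symmetric operator in $\mathcal H_0$ with $\operatorname{dom}S_0=\operatorname{dom}S$. $S$ is called regular if $S_0$ is closed. *)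

theory Defs
  imports "HOL-Analysis.Analysis"
begin

subsection \<open>Complex Hilbert spaces\<close>

class complex_vector = real_vector +
  fixes scaleC :: "complex \<Rightarrow> 'a \<Rightarrow> 'a"  (infixr \<open>*\<^sub>C\<close> 75)
  assumes scaleC_add_right: "a *\<^sub>C (x + y) = a *\<^sub>C x + a *\<^sub>C y"
    and scaleC_add_left: "(a + b) *\<^sub>C x = a *\<^sub>C x + b *\<^sub>C x"
    and scaleC_scaleC: "a *\<^sub>C (b *\<^sub>C x) = (a * b) *\<^sub>C x"
    and scaleC_one: "1 *\<^sub>C x = x"
    and scaleR_scaleC: "r *\<^sub>R x = complex_of_real r *\<^sub>C x"

global_interpretation complex_vector: vector_space "scaleC :: complex \<Rightarrow> 'a \<Rightarrow> 'a::complex_vector"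
  defines csubspace = "complex_vector.subspace"
    and cspan = "complex_vector.span"
  by unfold_locales
    (simp_all add: scaleC_add_right scaleC_add_left scaleC_scaleC scaleC_one)

text \<open>The inner product is linear in its first argument. Its real part is the inner product of the
  underlying real space, so that the norm, the topology and the definiteness of
  \<open>cinner\<close> come from class \<open>real_inner\<close>.\<close>

class complex_inner = complex_vector + real_inner +
  fixes cinner :: "'a \<Rightarrow> 'a \<Rightarrow> complex"
  assumes cinner_add_left: "cinner (x + y) z = cinner x z + cinner y z"
    and cinner_scaleC_left: "cinner (a *\<^sub>C x) y = a * cinner x y"
    and cinner_commute: "cinner x y = cnj (cinner y x)"
    and inner_eq_Re_cinner: "inner x y = Re (cinner x y)"

class complex_hilbert_space = complex_inner + complete_space

definition finite_cdim :: "'a::complex_vector set \<Rightarrow> bool"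
  where "finite_cdim V \<longleftrightarrow> (\<exists>B. finite B \<and> V \<subseteq> cspan B)"

definition orth_compl :: "'a::complex_inner set \<Rightarrow> 'a set"
  where "orth_compl M = {y. \<forall>x\<in>M. cinner x y = 0}"

text \<open>For a closed subspace \<open>M\<close> of a Hilbert space the described vector exists and is unique.\<close>

definition orth_proj :: "'a::complex_inner set \<Rightarrow> 'a \<Rightarrow> 'a"
  where "orth_proj M x = (THE y. y \<in> M \<and> x - y \<in> orth_compl M)"

subsection \<open>Unbounded operators\<close>

text \<open>A (not everywhere defined) operator is a partial function \<open>'a \<rightharpoonup> 'a\<close>: its domain is
  \<open>dom S\<close>, its value at \<open>f \<in> dom S\<close> is \<open>the (S f)\<close>, \<open>S \<subseteq>\<^sub>m T\<close> says that \<open>T\<close> extends \<open>S\<close>,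
  and equality of operators includes equality of domains.\<close>

definition linear_operator :: "('a::complex_vector \<rightharpoonup> 'a) \<Rightarrow> bool"
  where "linear_operator S \<longleftrightarrow> csubspace (dom S) \<and>
    (\<forall>f\<in>dom S. \<forall>g\<in>dom S. the (S (f + g)) = the (S f) + the (S g)) \<and>
    (\<forall>c. \<forall>f\<in>dom S. the (S (c *\<^sub>C f)) = c *\<^sub>C the (S f))"

definition symmetric_operator :: "('a::complex_inner \<rightharpoonup> 'a) \<Rightarrow> bool"
  where "symmetric_operator S \<longleftrightarrow> linear_operator S \<and> (\<forall>f\<in>dom S. Im (cinner (the (S f)) f) = 0)"

text \<open>For an operator acting in a closed subspace \<open>M\<close>, its graph is closed in \<open>M \<times> M\<close> iff it is
  closed in the whole product space, so the subspace need not be a parameter.\<close>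

definition closed_operator :: "('a::complex_inner \<rightharpoonup> 'a) \<Rightarrow> bool"
  where "closed_operator S \<longleftrightarrow> closed (Map.graph S)"

text \<open>Only meaningful for densely defined \<open>T\<close>, where the vector \<open>h\<close> is unique.\<close>

definition adjoint_operator :: "('a::complex_inner \<rightharpoonup> 'a) \<Rightarrow> ('a \<rightharpoonup> 'a)"
  where "adjoint_operator T g =
    (if \<exists>h. \<forall>f\<in>dom T. cinner (the (T f)) g = cinner f h
     then Some (THE h. \<forall>f\<in>dom T. cinner (the (T f)) g = cinner f h)
     else None)"

definition selfadjoint_operator :: "('a::complex_inner \<rightharpoonup> 'a) \<Rightarrow> bool"
  where "selfadjoint_operator T \<longleftrightarrow>
    linear_operator T \<and> closure (dom T) = UNIV \<and> adjoint_operator T = T"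

definition dom_closure :: "('a::complex_inner \<rightharpoonup> 'a) \<Rightarrow> 'a set"
  where "dom_closure S = closure (dom S)"

definition projected_operator :: "('a::complex_inner \<rightharpoonup> 'a) \<Rightarrow> ('a \<rightharpoonup> 'a)"
  where "projected_operator S = map_option (orth_proj (dom_closure S)) \<circ> S"

definition regular_operator :: "('a::complex_inner \<rightharpoonup> 'a) \<Rightarrow> bool"
  where "regular_operator S \<longleftrightarrow> closed_operator (projected_operator S)"

definition compression :: "'a::complex_inner set \<Rightarrow> ('a \<rightharpoonup> 'a) \<Rightarrow> ('a \<rightharpoonup> 'a)"
  where "compression M T = map_option (orth_proj M) \<circ> (T |` M)"

definition closed_symmetric_extension_in ::
    "'a::complex_inner set \<Rightarrow> ('a \<rightharpoonup> 'a) \<Rightarrow> ('a \<rightharpoonup> 'a) \<Rightarrow> bool"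
  where "closed_symmetric_extension_in M A B \<longleftrightarrow>
    symmetric_operator B \<and> closed_operator B \<and> dom B \<subseteq> M \<and> ran B \<subseteq> M \<and> A \<subseteq>\<^sub>m B"

end

theory Submission
  imports Defs
begin

text \<open>
  Write \<open>\<H> = \<H>\<^sub>0 \<oplus> N\<close> and let \<open>B\<close> be the prescribed closed symmetric operator in \<open>\<H>\<^sub>0\<close>. Since \<open>N\<close> is
  infinite-dimensional and \<open>\<H>\<^sub>0\<close> separable, there is an isometry \<open>V : \<H>\<^sub>0 \<rightarrow> N\<close>. The operator
  \<open>B \<oplus> (- V B V\<^sup>*) \<oplus> 0\<close> has the selfadjoint extension \<open>Q : x + V y + n \<mapsto> B\<^sup>* x - V B\<^sup>* y\<close>, where
  \<open>x, y \<in> dom B\<^sup>*\<close>, \<open>x - y \<in> dom B\<close> and \<open>n \<bottom> ran V\<close>, and its part in \<open>\<H>\<^sub>0\<close> is \<open>B\<close>. By regularity and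
  the closed graph theorem, \<open>S f = S\<^sub>0 f + C\<^sub>1 f + C\<^sub>2 S\<^sub>0 f\<close> with bounded \<open>C\<^sub>1, C\<^sub>2 : \<H> \<rightarrow> N\<close> that vanish
  on \<open>N\<close>. Then \<open>T = (I + C\<^sub>2) Q (I + C\<^sub>2\<^sup>*) + C\<^sub>1 + C\<^sub>1\<^sup>*\<close> is selfadjoint, because \<open>I + C\<^sub>2\<close> is
  invertible (\<open>C\<^sub>2\<^sup>2 = 0\<close>); and for \<open>g \<in> \<H>\<^sub>0\<close>, where the adjoints of \<open>C\<^sub>1\<close> and \<open>C\<^sub>2\<close> vanish, \<open>g \<in> dom T\<close>
  iff \<open>g \<in> dom B\<close>, with \<open>T g = B g + C\<^sub>1 g + C\<^sub>2 B g\<close>.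
\<close>

section \<open>Complex inner product spaces\<close>

instantiation prod :: (complex_vector, complex_vector) complex_vector
begin

definition scaleC_prod_def: "c *\<^sub>C p = (c *\<^sub>C fst p, c *\<^sub>C snd p)"

instance
  by standard
    (simp_all add: scaleC_prod_def scaleC_add_right scaleC_add_left scaleC_scaleC scaleC_one
      scaleR_prod_def scaleR_scaleC)

end

text \<open>Graphs of operators are subspaces of the product space. This instance gives orthogonal
  projections onto them, and adjoints of bounded maps defined on pairs.\<close>

instantiation prod :: (complex_inner, complex_inner) complex_inner
begin

definition cinner_prod_def: "cinner p q = cinner (fst p) (fst q) + cinner (snd p) (snd q)"

instance
proof
  fix p q :: "'a \<times> 'b"
  show "cinner p q = cnj (cinner q p)"
    by (simp add: cinner_prod_def cinner_commute[of "fst p"] cinner_commute[of "snd p"])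
qed (simp_all add: cinner_prod_def cinner_add_left cinner_scaleC_left scaleC_prod_def
    inner_eq_Re_cinner inner_prod_def algebra_simps)

end

instance complex_hilbert_space \<subseteq> banach ..

instance prod :: (complex_hilbert_space, complex_hilbert_space) complex_hilbert_space ..

lemma scaleC_Pair [simp]: "c *\<^sub>C (x, y) = (c *\<^sub>C x, c *\<^sub>C y)"
  by (simp add: scaleC_prod_def)

lemma cinner_Pair [simp]: "cinner (x, y) (x', y') = cinner x x' + cinner y y'"
  by (simp add: cinner_prod_def)

lemma scaleC_minus1: "(- 1) *\<^sub>C x = - (x::'a::complex_vector)"
  using scaleR_scaleC[of "-1" x] by simp

lemma scaleC_diff_right: "c *\<^sub>C (x - y) = c *\<^sub>C x - c *\<^sub>C (y::'a::complex_vector)"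
  using scaleC_add_right[of c "x - y" y] by (simp add: algebra_simps)

lemma csubspace_neg: "csubspace M \<Longrightarrow> x \<in> M \<Longrightarrow> - x \<in> M"
  by (metis complex_vector.subspace_scale scaleC_minus1)

lemma csubspace_imp_subspace: "csubspace M \<Longrightarrow> subspace M"
  unfolding subspace_def complex_vector.subspace_def by (simp add: scaleR_scaleC)

lemma csubspaceI:
  "0 \<in> M \<Longrightarrow> (\<And>x y. x \<in> M \<Longrightarrow> y \<in> M \<Longrightarrow> x + y \<in> M) \<Longrightarrow>
    (\<And>c x. x \<in> M \<Longrightarrow> c *\<^sub>C x \<in> M) \<Longrightarrow> csubspace M"
  unfolding complex_vector.subspace_def by blast

lemma cinner_scaleC_right: "cinner (x::'a::complex_inner) (a *\<^sub>C y) = cnj a * cinner x y"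
  by (metis cinner_commute cinner_scaleC_left complex_cnj_mult)

lemma cinner_add_right: "cinner (x::'a::complex_inner) (y + z) = cinner x y + cinner x z"
  by (metis cinner_add_left cinner_commute complex_cnj_add)

lemma cinner_zero_left [simp]: "cinner 0 (x::'a::complex_inner) = 0"
  using cinner_add_left[of 0 0 x] by simp

lemma cinner_zero_right [simp]: "cinner (x::'a::complex_inner) 0 = 0"
  using cinner_add_right[of x 0 0] by simp

lemma cinner_minus_left [simp]: "cinner (- (x::'a::complex_inner)) y = - cinner x y"
  using cinner_add_left[of x "- x" y] by (simp add: add_eq_0_iff)

lemma cinner_minus_right [simp]: "cinner (x::'a::complex_inner) (- y) = - cinner x y"
  by (metis cinner_commute cinner_minus_left complex_cnj_minus)

lemma cinner_diff_left: "cinner ((x::'a::complex_inner) - y) z = cinner x z - cinner y z"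
  using cinner_add_left[of x "- y" z] by simp

lemma cinner_diff_right: "cinner (x::'a::complex_inner) (y - z) = cinner x y - cinner x z"
  using cinner_add_right[of x y "- z"] by simp

lemma cinner_eq_0_commute: "cinner (x::'a::complex_inner) y = 0 \<longleftrightarrow> cinner y x = 0"
  by (metis cinner_commute complex_cnj_zero)

lemma cinner_self: "cinner (x::'a::complex_inner) x = complex_of_real ((norm x)\<^sup>2)"
proof -
  have "Im (cinner x x) = 0"
    using cinner_commute[of x x] by (simp add: complex_eq_iff)
  moreover have "Re (cinner x x) = (norm x)\<^sup>2"
    by (simp add: power2_norm_eq_inner inner_eq_Re_cinner)
  ultimately show ?thesis by (simp add: complex_eq_iff)
qed

lemma cinner_eq_zero_iff [simp]: "cinner (x::'a::complex_inner) x = 0 \<longleftrightarrow> x = 0"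
  by (simp add: cinner_self)

lemma norm_scaleC: "norm (c *\<^sub>C x) = cmod c * norm (x::'a::complex_inner)"
proof -
  have "complex_of_real ((norm (c *\<^sub>C x))\<^sup>2) = complex_of_real ((cmod c * norm x)\<^sup>2)"
    unfolding cinner_self[symmetric] cinner_scaleC_left cinner_scaleC_right
    using complex_norm_square[of c] by (simp add: cinner_self power_mult_distrib mult.commute)
  then have "(norm (c *\<^sub>C x))\<^sup>2 = (cmod c * norm x)\<^sup>2"
    unfolding of_real_eq_iff .
  then show ?thesis by (simp add: power2_eq_iff_nonneg)
qed

lemma Im_cinner: "Im (cinner x y) = inner x (\<i> *\<^sub>C y)"
  by (simp add: inner_eq_Re_cinner cinner_scaleC_right)

text \<open>The real Cauchy-Schwarz inequality bounds the real and the imaginary part separately,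
  whence the factor 2; any constant serves \<open>bounded_bilinear_cinner\<close>.\<close>

lemma cmod_cinner_le: "cmod (cinner x y) \<le> norm x * norm y * 2"
proof -
  have "\<bar>Re (cinner x y)\<bar> \<le> norm x * norm y"
    using Cauchy_Schwarz_ineq2[of x y] by (simp add: inner_eq_Re_cinner)
  moreover have "\<bar>Im (cinner x y)\<bar> \<le> norm x * norm y"
    using Cauchy_Schwarz_ineq2[of x "\<i> *\<^sub>C y"] by (simp add: Im_cinner norm_scaleC)
  ultimately show ?thesis using cmod_le[of "cinner x y"] by linarith
qed

lemma bounded_bilinear_cinner: "bounded_bilinear (cinner :: 'a \<Rightarrow> 'a::complex_inner \<Rightarrow> complex)"
proof
  show "\<exists>K. \<forall>a b. cmod (cinner a (b::'a)) \<le> norm a * norm b * K"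
    using cmod_cinner_le by blast
qed (simp_all add: cinner_add_left cinner_add_right scaleR_scaleC cinner_scaleC_left
    cinner_scaleC_right scaleR_conv_of_real)

lemmas continuous_on_cinner [continuous_intros] =
  bounded_bilinear.continuous_on[OF bounded_bilinear_cinner]

lemma bounded_linear_scaleC: "bounded_linear (\<lambda>x. c *\<^sub>C (x::'a::complex_inner))"
  by (rule bounded_linear_intro[where K = "cmod c"])
    (simp_all add: scaleC_add_right scaleR_scaleC scaleC_scaleC norm_scaleC mult.commute)

lemmas continuous_on_scaleC [continuous_intros] =
  bounded_linear.continuous_on[OF bounded_linear_scaleC]

section \<open>Closed subspaces and orthogonal complements\<close>

lemma csubspace_closure:
  fixes M :: "'a::complex_inner set"
  assumes "csubspace M"
  shows "csubspace (closure M)"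
proof (rule csubspaceI)
  show "0 \<in> closure M"
    using assms closure_subset complex_vector.subspace_0 by blast
  show "x + y \<in> closure M" if "x \<in> closure M" "y \<in> closure M" for x y
  proof -
    obtain u v where "\<forall>n. u n \<in> M" "u \<longlonglongrightarrow> x" "\<forall>n. v n \<in> M" "v \<longlonglongrightarrow> y"
      using \<open>x \<in> closure M\<close> \<open>y \<in> closure M\<close> unfolding closure_sequential by blast
    then have "\<forall>n. u n + v n \<in> M" "(\<lambda>n. u n + v n) \<longlonglongrightarrow> x + y"
      using assms by (auto intro: tendsto_add complex_vector.subspace_add)
    then show ?thesis unfolding closure_sequential
      by (intro exI[of _ "\<lambda>n. u n + v n"] conjI)
  qed
  show "c *\<^sub>C x \<in> closure M" if "x \<in> closure M" for c x
  proof -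
    have "(*\<^sub>C) c ` closure M \<subseteq> closure M"
      by (rule image_closure_subset)
        (use assms closure_subset[of M] complex_vector.subspace_scale[of M] in
          \<open>auto intro!: continuous_intros\<close>)
    then show ?thesis using that by blast
  qed
qed

lemma closed_orth_compl: "closed (orth_compl M)"
proof -
  have "orth_compl M = (\<Inter>x\<in>M. {y. cinner x y = 0})" by (auto simp: orth_compl_def)
  moreover have "closed {y. cinner x y = 0}" for x :: 'a
    by (intro closed_Collect_eq continuous_intros)
  ultimately show ?thesis by (simp add: closed_INT)
qed

lemma csubspace_orth_compl: "csubspace (orth_compl M)"
  by (rule csubspaceI) (auto simp: orth_compl_def cinner_add_right cinner_scaleC_right)

lemma closure_cspan_subset:
  "closed M \<Longrightarrow> csubspace M \<Longrightarrow> B \<subseteq> M \<Longrightarrow> closure (cspan B) \<subseteq> M"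
  by (simp add: closure_minimal complex_vector.span_minimal)

lemma orth_complD: "y \<in> orth_compl M \<Longrightarrow> x \<in> M \<Longrightarrow> cinner x y = 0"
  by (simp add: orth_compl_def)

lemma orth_complD': "y \<in> orth_compl M \<Longrightarrow> x \<in> M \<Longrightarrow> cinner y x = 0"
  using cinner_eq_0_commute orth_complD by blast

lemma orth_compl_subset_iff: "A \<subseteq> orth_compl B \<longleftrightarrow> B \<subseteq> orth_compl A"
  unfolding orth_compl_def using cinner_eq_0_commute by blast

text \<open>By \<open>orth_compl_subset_iff\<close> the nontrivial inclusion says that
  \<open>closure M\<close> lies in the double complement of \<open>M\<close>, which is closed and
  contains \<open>M\<close>.\<close>

lemma orth_compl_closure: "orth_compl (closure M) = orth_compl M"
proof
  show "orth_compl (closure M) \<subseteq> orth_compl M"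
    using closure_subset[of M] by (auto simp: orth_compl_def)
  show "orth_compl M \<subseteq> orth_compl (closure M)"
    by (meson orth_compl_subset_iff closure_minimal closed_orth_compl order_refl)
qed

lemma orth_compl_Int: "x \<in> M \<Longrightarrow> x \<in> orth_compl M \<Longrightarrow> x = 0"
  using orth_complD by fastforce

section \<open>Orthogonal projections\<close>

lemma parallelogram_midpoint:
  fixes x y z :: "'a::real_inner"
  shows "(norm (y - z))\<^sup>2 = 2 * (norm (x - y))\<^sup>2 + 2 * (norm (x - z))\<^sup>2
    - 4 * (norm (x - (1/2) *\<^sub>R (y + z)))\<^sup>2"
  by (simp add: power2_norm_eq_inner inner_diff_left inner_diff_right inner_add_left inner_add_right
      inner_commute algebra_simps)

text \<open>A minimising sequence is Cauchy by \<open>parallelogram_midpoint\<close>, because the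
  midpoints stay in \<open>M\<close> and so have distance at least \<open>d\<close> from
  \<open>x\<close>. Its limit attains the distance.\<close>

lemma nearest_point_exists:
  fixes M :: "'a::{real_inner, complete_space} set"
  assumes "closed M" "subspace M"
  obtains y where "y \<in> M" "\<And>z. z \<in> M \<Longrightarrow> norm (x - y) \<le> norm (x - z)"
proof -
  define d where "d = infdist x M"
  have ne: "M \<noteq> {}" using assms(2) subspace_0 by blast
  have d0: "0 \<le> d" by (simp add: d_def infdist_nonneg)
  have dle: "d \<le> norm (x - z)" if "z \<in> M" for z
    using infdist_le[OF that, of x] by (simp add: d_def dist_norm)
  have "\<exists>y\<in>M. norm (x - y) < d + 1 / real (Suc n)" for n
  proof -
    have "Inf {dist x a |a. a \<in> M} < d + 1 / real (Suc n)"
      using ne by (simp add: d_def infdist_notempty image_def Setcompr_eq_image)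
    then show ?thesis
      using cInf_lessD[of "{dist x a |a. a \<in> M}"] ne by (auto simp: dist_norm)
  qed
  then obtain y where yM: "\<And>n. y n \<in> M" and yd: "\<And>n. norm (x - y n) < d + 1 / real (Suc n)"
    by metis
  have est: "(norm (y m - y n))\<^sup>2 \<le> 4 * (2 * d + 1) / real (Suc N)" if "N \<le> m" "N \<le> n" for m n N
  proof -
    define e where "e = 1 / real (Suc N)"
    have e: "0 < e" "e \<le> 1" by (simp_all add: e_def)
    have "1 / real (Suc k) \<le> e" if "N \<le> k" for k using that by (simp add: e_def frac_le)
    then have le: "(norm (x - y k))\<^sup>2 \<le> (d + e)\<^sup>2" if "N \<le> k" for k
      using yd[of k] that by (intro power_mono) (fastforce, simp)
    have "(1/2) *\<^sub>R (y m + y n) \<in> M"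
      using yM assms(2) by (simp add: subspace_add subspace_scale)
    then have "d\<^sup>2 \<le> (norm (x - (1/2) *\<^sub>R (y m + y n)))\<^sup>2"
      by (intro power_mono dle d0)
    then have "(norm (y m - y n))\<^sup>2 \<le> 4 * (d + e)\<^sup>2 - 4 * d\<^sup>2"
      using parallelogram_midpoint[of "y m" "y n" x] le[OF that(1)] le[OF that(2)] by linarith
    also have "\<dots> = 4 * (2 * d + e) * e" by (simp add: power2_eq_square algebra_simps)
    also have "\<dots> \<le> 4 * (2 * d + 1) * e" using e d0 by (intro mult_right_mono) auto
    finally show ?thesis by (simp add: e_def)
  qed
  have "Cauchy y"
  proof (rule metric_CauchyI)
    fix \<epsilon> :: real assume "0 < \<epsilon>"
    then have "0 < \<epsilon>\<^sup>2 / (4 * (2 * d + 1))" using d0 by simp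
    then obtain N where "inverse (real (Suc N)) < \<epsilon>\<^sup>2 / (4 * (2 * d + 1))"
      using reals_Archimedean by blast
    then have "4 * (2 * d + 1) / real (Suc N) < \<epsilon>\<^sup>2"
      using d0 by (simp add: field_simps)
    then have "dist (y m) (y n) < \<epsilon>" if "N \<le> m" "N \<le> n" for m n
      using est[OF that] \<open>0 < \<epsilon>\<close> by (metis dist_norm le_less_trans less_imp_le power_less_imp_less_base)
    then show "\<exists>N. \<forall>m\<ge>N. \<forall>n\<ge>N. dist (y m) (y n) < \<epsilon>" by blast
  qed
  then obtain l where l: "y \<longlonglongrightarrow> l" using Cauchy_convergent convergent_def by blast
  have "l \<in> M" using closed_sequentially[OF assms(1) _ l] yM by blast
  moreover have "norm (x - l) \<le> d"
  proof (rule LIMSEQ_le)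
    show "(\<lambda>n. norm (x - y n)) \<longlonglongrightarrow> norm (x - l)" by (intro tendsto_intros l)
    show "(\<lambda>n. d + 1 / real (Suc n)) \<longlonglongrightarrow> d"
      using tendsto_add[OF tendsto_const[of d] LIMSEQ_inverse_real_of_nat]
      by (simp add: inverse_eq_divide)
    show "\<exists>N. \<forall>n\<ge>N. norm (x - y n) \<le> d + 1 / real (Suc n)" using yd less_imp_le by blast
  qed
  ultimately show thesis using dle that order_trans by blast
qed

lemma orth_decomp_exists:
  fixes M :: "'a::complex_hilbert_space set"
  assumes "closed M" "csubspace M"
  shows "\<exists>y\<in>M. x - y \<in> orth_compl M"
proof -
  obtain y where y: "y \<in> M" and min: "\<And>z. z \<in> M \<Longrightarrow> norm (x - y) \<le> norm (x - z)"
    using nearest_point_exists[OF assms(1) csubspace_imp_subspace[OF assms(2)]] by blast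
  have re: "inner (x - y) z = 0" if z: "z \<in> M" for z
  proof (cases "z = 0")
    case False
    \<comment> \<open>This \<open>t\<close> minimises the distance from \<open>x - y\<close> to the
      real multiples of \<open>z\<close>, so the minimality of \<open>y\<close> forces the gain to
      vanish.\<close>
    define t where "t = inner (x - y) z / inner z z"
    have "y + t *\<^sub>R z \<in> M"
      using y z csubspace_imp_subspace[OF assms(2)] by (simp add: subspace_add subspace_scale)
    then have "(norm (x - y))\<^sup>2 \<le> (norm (x - y - t *\<^sub>R z))\<^sup>2"
      using min[of "y + t *\<^sub>R z"] by (intro power_mono) (simp_all add: algebra_simps)
    also have "\<dots> = (norm (x - y))\<^sup>2 - (inner (x - y) z)\<^sup>2 / inner z z"
      using False unfolding power2_norm_eq_inner
      by (simp add: t_def inner_diff_left[of "x - y"] inner_diff_right[of _ "x - y"]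
          inner_commute[of z "x - y"] power2_eq_square)
    finally have "(inner (x - y) z)\<^sup>2 / inner z z \<le> 0" by simp
    then show ?thesis using False
      by (metis divide_pos_pos inner_gt_zero_iff not_le zero_less_power2)
  qed simp
  \<comment> \<open>The vector \<open>\<i> *\<^sub>C z\<close> also lies in \<open>M\<close>;
    testing with it yields the imaginary part.\<close>
  have "cinner (x - y) z = 0" if "z \<in> M" for z
    using re[OF that] re[of "\<i> *\<^sub>C z"] that assms(2)
    by (simp add: complex_eq_iff Im_cinner complex_vector.subspace_scale inner_eq_Re_cinner[symmetric])
  then show ?thesis using y unfolding orth_compl_def
    using cinner_eq_0_commute by blast
qed

lemma orth_proj_unique:
  assumes "csubspace M" "y \<in> M" "x - y \<in> orth_compl M"
  shows "orth_proj M x = y"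
  unfolding orth_proj_def
proof (rule the_equality)
  fix z assume z: "z \<in> M \<and> x - z \<in> orth_compl M"
  then have "z - y \<in> M" using assms complex_vector.subspace_diff by blast
  moreover have "z - y \<in> orth_compl M"
    using complex_vector.subspace_diff[OF csubspace_orth_compl assms(3), of "x - z"] z by simp
  ultimately show "z = y" using orth_compl_Int by fastforce
qed (use assms in auto)

context
  fixes M :: "'a::complex_hilbert_space set"
  assumes M: "closed M" "csubspace M"
begin

lemma orth_proj_in: "orth_proj M x \<in> M"
  and orth_proj_orth: "x - orth_proj M x \<in> orth_compl M"
  using orth_decomp_exists[OF M, of x] orth_proj_unique[OF M(2)] by blast+

lemma orth_proj_id: "x \<in> M \<Longrightarrow> orth_proj M x = x"
  by (rule orth_proj_unique) (simp_all add: M orth_compl_def)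

lemma orth_proj_orth_compl: "x \<in> orth_compl M \<Longrightarrow> orth_proj M x = 0"
  by (rule orth_proj_unique) (simp_all add: M complex_vector.subspace_0)

lemma orth_proj_add: "orth_proj M (x + y) = orth_proj M x + orth_proj M y"
proof (rule orth_proj_unique[OF M(2)])
  show "x + y - (orth_proj M x + orth_proj M y) \<in> orth_compl M"
    using complex_vector.subspace_add[OF csubspace_orth_compl orth_proj_orth[of x] orth_proj_orth[of y]]
    by (simp add: algebra_simps)
qed (simp add: M complex_vector.subspace_add orth_proj_in)

lemma orth_proj_scaleC: "orth_proj M (c *\<^sub>C x) = c *\<^sub>C orth_proj M x"
proof (rule orth_proj_unique[OF M(2)])
  show "c *\<^sub>C x - c *\<^sub>C orth_proj M x \<in> orth_compl M"
    using complex_vector.subspace_scale[OF csubspace_orth_compl orth_proj_orth[of x]]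
    by (simp add: scaleC_diff_right)
qed (simp add: M complex_vector.subspace_scale orth_proj_in)

lemma cinner_orth_proj_left: "y \<in> M \<Longrightarrow> cinner (orth_proj M x) y = cinner x y"
  using orth_complD'[OF orth_proj_orth, of y x] by (simp add: cinner_diff_left)

lemma norm_orth_proj_le: "norm (orth_proj M x) \<le> norm x"
proof -
  have "complex_of_real ((norm x)\<^sup>2) =
      complex_of_real ((norm (orth_proj M x))\<^sup>2) + complex_of_real ((norm (x - orth_proj M x))\<^sup>2)"
    using orth_complD[OF orth_proj_orth[of x] orth_proj_in[of x]]
      orth_complD'[OF orth_proj_orth[of x] orth_proj_in[of x]]
    unfolding cinner_self[symmetric] by (simp add: cinner_diff_left cinner_diff_right)
  then have "(norm x)\<^sup>2 = (norm (orth_proj M x))\<^sup>2 + (norm (x - orth_proj M x))\<^sup>2"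
    unfolding of_real_add[symmetric] of_real_eq_iff .
  then show ?thesis by (metis le_add_same_cancel1 norm_ge_zero power2_le_imp_le zero_le_power2)
qed

lemma bounded_linear_orth_proj: "bounded_linear (orth_proj M)"
  by (rule bounded_linear_intro[where K = 1])
    (simp_all add: orth_proj_add scaleR_scaleC orth_proj_scaleC norm_orth_proj_le)

end

lemma orth_compl_orth_compl:
  fixes M :: "'a::complex_hilbert_space set"
  assumes "closed M" "csubspace M" "x \<in> orth_compl (orth_compl M)"
  shows "x \<in> M"
proof -
  have "cinner (x - orth_proj M x) (x - orth_proj M x) = 0"
    using orth_complD[OF assms(3) orth_proj_orth[OF assms(1,2)]]
      orth_complD'[OF orth_proj_orth[OF assms(1,2)] orth_proj_in[OF assms(1,2)]]
    by (simp add: cinner_diff_right)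
  then show ?thesis using orth_proj_in[OF assms(1,2), of x] by simp
qed

section \<open>The Riesz representation theorem and adjoints of bounded operators\<close>

text \<open>The component \<open>w\<close> of \<open>x0\<close> orthogonal to the kernel represents
  the functional up to a scalar: pairing the kernel vector
  \<open>\<phi> x *\<^sub>C w - \<phi> w *\<^sub>C x\<close> with \<open>w\<close> gives the
  formula.\<close>

lemma Riesz_representation:
  fixes \<phi> :: "'a::complex_hilbert_space \<Rightarrow> complex"
  assumes "bounded_linear \<phi>" "\<And>c x. \<phi> (c *\<^sub>C x) = c * \<phi> x"
  shows "\<exists>y. \<forall>x. \<phi> x = cinner x y"
proof (cases "\<forall>x. \<phi> x = 0")
  case True
  then show ?thesis by (auto intro: exI[of _ 0])
next
  case False
  then obtain x0 where x0: "\<phi> x0 \<noteq> 0" by blast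
  interpret \<phi>: bounded_linear \<phi> by fact
  define M where "M = {x. \<phi> x = 0}"
  have M: "closed M" "csubspace M"
    unfolding M_def
    by (auto intro!: closed_Collect_eq continuous_intros csubspaceI \<phi>.continuous_on
        simp: \<phi>.add assms(2))
  define w where "w = x0 - orth_proj M x0"
  have w: "w \<in> orth_compl M" unfolding w_def by (rule orth_proj_orth[OF M])
  have \<phi>w: "\<phi> w \<noteq> 0"
    using x0 orth_proj_in[OF M, of x0] by (simp add: w_def \<phi>.diff M_def)
  then have w0: "w \<noteq> 0" by auto
  have "\<phi> x = cinner x ((cnj (\<phi> w) / cinner w w) *\<^sub>C w)" for x
  proof -
    have "\<phi> x *\<^sub>C w - \<phi> w *\<^sub>C x \<in> M" by (simp add: M_def \<phi>.diff assms(2))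
    then have "\<phi> x * cinner w w = \<phi> w * cinner x w"
      using orth_complD[OF w, of "\<phi> x *\<^sub>C w - \<phi> w *\<^sub>C x"]
      by (simp add: cinner_diff_left cinner_scaleC_left)
    then show ?thesis using w0
      by (simp add: cinner_scaleC_right cinner_self field_simps)
  qed
  then show ?thesis by blast
qed

lemma bounded_adjoint_exists:
  fixes F :: "'a::complex_hilbert_space \<Rightarrow> 'b::complex_inner"
  assumes "bounded_linear F" "\<And>c x. F (c *\<^sub>C x) = c *\<^sub>C F x"
  shows "\<exists>F'. \<forall>x y. cinner (F x) y = cinner x (F' y)"
proof -
  have "\<exists>z. \<forall>x. cinner (F x) y = cinner x z" for y
    by (rule Riesz_representation)
      (auto intro: bounded_linear_compose[OF bounded_bilinear.bounded_linear_left[OF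
            bounded_bilinear_cinner] assms(1)] simp: assms(2) cinner_scaleC_left)
  then show ?thesis by metis
qed

section \<open>The closed graph theorem\<close>

text \<open>By Baire, the closure of some set on which \<open>k\<close> is bounded contains a ball.
  Hence every \<open>x\<close> is approximable by vectors \<open>u\<close> with
  \<open>norm (k u)\<close> at most \<open>c * norm x\<close>. Correcting the error repeatedly
  writes \<open>x\<close> as a series whose image series converges absolutely, and closedness of the
  graph identifies the sum of the images with \<open>k x\<close>.\<close>

lemma closed_graph_theorem:
  fixes k :: "'a::banach \<Rightarrow> 'b::banach"
  assumes lin: "linear k" and cl: "closed {(x, k x) |x. True}"
  shows "bounded_linear k"
proof -
  interpret linear k by fact
  define A where "A n = closure {x. norm (k x) \<le> real n}" for n
  have "\<exists>n. interior (A n) \<noteq> {}"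
  proof (rule ccontr)
    assume *: "\<nexists>n. interior (A n) \<noteq> {}"
    have "Met_TC.mtopology interior_of \<Union>(range A) = {}"
      by (rule Met_TC.metric_Baire_category_alt)
        (use * in \<open>auto simp: complete_UNIV A_def\<close>)
    moreover have "\<Union>(range A) = UNIV"
    proof -
      have "x \<in> A (nat \<lceil>norm (k x)\<rceil>)" for x
        unfolding A_def by (rule subsetD[OF closure_subset]) (simp add: real_nat_ceiling_ge)
      then show ?thesis by blast
    qed
    ultimately show False by simp
  qed
  then obtain n x0 r where r: "0 < r" "ball x0 r \<subseteq> A n"
    using mem_interior by blast
  \<comment> \<open>A small vector \<open>x\<close> is the difference of \<open>x0 + x\<close> and
    \<open>x0\<close>, both in the ball; approximating both doubles the bound on
    \<open>k\<close>.\<close>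
  have dense0: "\<exists>u. norm (k u) \<le> 2 * real n \<and> norm (x - u) < \<epsilon>" if "norm x < r" "0 < \<epsilon>" for x \<epsilon>
  proof -
    have "x0 + x \<in> A n" "x0 \<in> A n"
      using that r by (auto simp: subset_iff dist_norm)
    moreover have "0 < \<epsilon> / 2" using \<open>0 < \<epsilon>\<close> by simp
    ultimately obtain a b where ab: "norm (k a) \<le> n" "dist a (x0 + x) < \<epsilon>/2"
        "norm (k b) \<le> n" "dist b x0 < \<epsilon>/2"
      unfolding A_def closure_approachable by blast
    have "norm (x - (a - b)) \<le> norm (x0 + x - a) + norm (b - x0)"
      using norm_triangle_ineq[of "x0 + x - a" "b - x0"] by (simp add: algebra_simps)
    also have "\<dots> < \<epsilon>"
      using ab by (simp add: dist_norm norm_minus_commute)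
    finally have "norm (x - (a - b)) < \<epsilon>" .
    moreover have "norm (k (a - b)) \<le> 2 * real n"
      using norm_triangle_ineq4[of "k a" "k b"] ab by (simp add: diff)
    ultimately show ?thesis by blast
  qed
  define c where "c = 4 * real n / r"
  have dense: "\<exists>u. norm (k u) \<le> c * norm x \<and> norm (x - u) < \<epsilon>" if "0 < \<epsilon>" for x \<epsilon>
  proof (cases "x = 0")
    case True
    then show ?thesis using that by (auto intro!: exI[of _ 0] simp: zero)
  next
    case False
    \<comment> \<open>Scaling by \<open>t\<close> brings \<open>x\<close> to norm
      \<open>r / 2\<close>; scaling back turns the bound \<open>2 * real n\<close> into
      \<open>c * norm x\<close>.\<close>
    define t where "t = r / (2 * norm x)"
    have t: "0 < t" using False r by (simp add: t_def)
    have "norm (t *\<^sub>R x) < r" using False r by (simp add: t_def)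
    then obtain u where u: "norm (k u) \<le> 2 * real n" "norm (t *\<^sub>R x - u) < t * \<epsilon>"
      using dense0[of "t *\<^sub>R x" "t * \<epsilon>"] t \<open>0 < \<epsilon>\<close> by auto
    have "x - (1 / t) *\<^sub>R u = (1 / t) *\<^sub>R (t *\<^sub>R x - u)"
      using t by (simp add: algebra_simps)
    then have "norm (x - (1 / t) *\<^sub>R u) = norm (t *\<^sub>R x - u) / t" using t by simp
    also have "\<dots> < \<epsilon>" using u(2) t by (simp add: field_simps)
    finally have "norm (x - (1 / t) *\<^sub>R u) < \<epsilon>" .
    moreover have "norm (k ((1 / t) *\<^sub>R u)) \<le> c * norm x"
    proof -
      have "norm (k ((1 / t) *\<^sub>R u)) = norm (k u) / t" using t by (simp add: scale)
      also have "\<dots> \<le> 2 * real n / t" using u(1) t by (intro divide_right_mono) auto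
      also have "\<dots> = c * norm x" using False r by (simp add: t_def c_def)
      finally show ?thesis .
    qed
    ultimately show ?thesis by blast
  qed
  define w where "w x \<epsilon> = (SOME u. norm (k u) \<le> c * norm x \<and> norm (x - u) < \<epsilon>)" for x \<epsilon>
  have w: "norm (k (w x \<epsilon>)) \<le> c * norm x" "norm (x - w x \<epsilon>) < \<epsilon>" if "0 < \<epsilon>" for x \<epsilon>
    using someI_ex[OF dense[OF that, of x]] by (simp_all add: w_def)
  have c0: "0 \<le> c" using r by (simp add: c_def)
  have "norm (k x) \<le> norm x * (2 * c)" for x
  proof (cases "x = 0")
    case False
    define \<delta> where "\<delta> = norm x"
    have \<delta>: "0 < \<delta>" using False by (simp add: \<delta>_def)
    \<comment> \<open>Here \<open>y j\<close> is the remainder after \<open>j\<close> corrections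
      and \<open>z j\<close> the next correction. The prescribed errors halve at each step, which
      gives the geometric bounds on both.\<close>
    define y where "y = rec_nat x (\<lambda>j z. z - w z (\<delta> * (1/2) ^ Suc j))"
    define z where "z j = w (y j) (\<delta> * (1/2) ^ Suc j)" for j
    have y0: "y 0 = x" and ySuc: "y (Suc j) = y j - z j" for j
      by (simp_all add: y_def z_def)
    have ny: "norm (y j) \<le> \<delta> * (1/2) ^ j" for j
    proof (cases j)
      case (Suc i)
      show ?thesis unfolding Suc ySuc z_def
        by (rule less_imp_le, rule w(2)) (use \<delta> in simp)
    qed (simp add: y0 \<delta>_def)
    have kz: "norm (k (z j)) \<le> c * \<delta> * (1/2) ^ j" for j
    proof -
      have "norm (k (z j)) \<le> c * norm (y j)" unfolding z_def by (rule w(1)) (use \<delta> in simp)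
      also have "\<dots> \<le> c * (\<delta> * (1/2) ^ j)" by (intro mult_left_mono ny c0)
      finally show ?thesis by (simp add: mult.assoc)
    qed
    have geo: "(\<lambda>j. c * \<delta> * (1/2) ^ j) sums (c * \<delta> * 2)"
      using sums_mult[OF geometric_sums[of "1/2::real"], of "c * \<delta>"] by simp
    have summ: "summable (\<lambda>j. norm (k (z j)))"
      by (rule summable_comparison_test'[OF sums_summable[OF geo], of 0]) (use kz in simp)
    then have L: "(\<lambda>m. \<Sum>j<m. k (z j)) \<longlonglongrightarrow> (\<Sum>j. k (z j))"
      by (rule summable_LIMSEQ[OF summable_norm_cancel])
    have "y \<longlonglongrightarrow> 0"
    proof (rule Lim_null_comparison)
      show "(\<lambda>j. \<delta> * (1/2) ^ j) \<longlonglongrightarrow> 0"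
        by (intro tendsto_mult_right_zero LIMSEQ_realpow_zero) auto
      show "\<forall>\<^sub>F j in sequentially. norm (y j) \<le> \<delta> * (1/2) ^ j"
        using ny by simp
    qed
    moreover have "(\<Sum>j<m. z j) = x - y m" for m
      by (induction m) (simp_all add: y0 ySuc)
    ultimately have S: "(\<lambda>m. \<Sum>j<m. z j) \<longlonglongrightarrow> x"
      using tendsto_diff[OF tendsto_const[of x], of y 0] by simp
    have "(x, \<Sum>j. k (z j)) \<in> {(x, k x) |x. True}"
    proof (rule closed_sequentially[OF cl])
      show "(\<lambda>m. (\<Sum>j<m. z j, \<Sum>j<m. k (z j))) \<longlonglongrightarrow> (x, \<Sum>j. k (z j))"
        by (intro tendsto_Pair S L)
    qed (simp add: sum)
    then have "norm (k x) = norm (\<Sum>j. k (z j))" by simp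
    also have "\<dots> \<le> (\<Sum>j. norm (k (z j)))" by (rule summable_norm[OF summ])
    also have "\<dots> \<le> c * \<delta> * 2"
      using suminf_le[OF kz summ sums_summable[OF geo]] sums_unique[OF geo] by simp
    finally show ?thesis by (simp add: \<delta>_def mult_ac)
  qed (simp add: zero)
  then show ?thesis
    by (intro bounded_linear_intro[where K = "2 * c"]) (simp_all add: add scale)
qed

section \<open>Linear relations\<close>

text \<open>The adjoint of a relation makes sense without density or single-valuedness.
  Selfadjointness can thus be proved before the relation is known to be the graph of an
  operator.\<close>

definition adjoint_rel :: "('a::complex_inner \<times> 'a) set \<Rightarrow> ('a \<times> 'a) set"
  where "adjoint_rel R = {(g, h). \<forall>(f, k)\<in>R. cinner k g = cinner f h}"

lemma mem_adjoint_rel_iff: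
  "(g, h) \<in> adjoint_rel R \<longleftrightarrow> (\<forall>f k. (f, k) \<in> R \<longrightarrow> cinner k g = cinner f h)"
  by (auto simp: adjoint_rel_def)

lemma csubspace_adjoint_rel: "csubspace (adjoint_rel R)"
  by (rule csubspaceI)
    (auto simp: mem_adjoint_rel_iff zero_prod_def cinner_add_right cinner_scaleC_right)

lemma adjoint_relD: "(g, h) \<in> adjoint_rel R \<Longrightarrow> (f, k) \<in> R \<Longrightarrow> cinner k g = cinner f h"
  by (auto simp: adjoint_rel_def)

lemma adjoint_relD': "(g, h) \<in> adjoint_rel R \<Longrightarrow> (f, k) \<in> R \<Longrightarrow> cinner g k = cinner h f"
  using adjoint_relD cinner_commute by metis

text \<open>This is stability of selfadjointness under congruence by an invertible \<open>A\<close>,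
  with inverse \<open>C\<close>, and under adding a symmetric everywhere defined \<open>D\<close>.
  Membership in \<open>Q\<close> means \<open>(A' g, C (h - D g)) \<in> R\<close>, and the defining
  identities of the two adjoints correspond under the same substitution.\<close>

lemma selfadjoint_rel_congruence:
  fixes R :: "('a::complex_inner \<times> 'a) set" and A A' C C' D :: "'a \<Rightarrow> 'a"
  assumes R: "adjoint_rel R = R"
    and A: "\<And>x y. cinner (A x) y = cinner x (A' y)"
    and C: "\<And>x y. cinner (C x) y = cinner x (C' y)"
    and D: "\<And>x y. cinner (D x) y = cinner x (D y)"
    and AC: "\<And>x. A (C x) = x" and CA: "\<And>x. C (A x) = x"
  defines "Q \<equiv> {(g, h). \<exists>t. (A' g, t) \<in> R \<and> h = A t + D g}"
  shows "adjoint_rel Q = Q"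
proof -
  have ext: "x = y" if "\<And>z. cinner z x = cinner z y" for x y :: 'a
  proof -
    have "cinner (x - y) (x - y) = 0" using that by (simp add: cinner_diff_right)
    then show ?thesis by simp
  qed
  have A'C': "A' (C' x) = x" and C'A': "C' (A' x) = x" for x
    by (rule ext; simp flip: A C add: AC CA)+
  have mem: "(g, h) \<in> Q \<longleftrightarrow> (A' g, C (h - D g)) \<in> R" for g h
  proof
    assume "(A' g, C (h - D g)) \<in> R"
    moreover have "h = A (C (h - D g)) + D g" by (simp add: AC)
    ultimately show "(g, h) \<in> Q" unfolding Q_def by blast
  qed (auto simp: Q_def CA)
  have "(g, h) \<in> adjoint_rel Q \<longleftrightarrow> (g, h) \<in> Q" for g h
  proof -
    \<comment> \<open>The substitution \<open>f = C' z\<close> moves \<open>C\<close> across the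
      inner product, and the two contributions of \<open>D\<close> cancel by its symmetry.\<close>
    have step: "cinner k g = cinner f h \<longleftrightarrow> cinner t (A' g) = cinner z (C (h - D g))"
      if "z = A' f" "k = A t + D f" for f k z t
    proof -
      have "C' z = f" using that C'A' by simp
      then have "cinner f h = cinner f (D g) + cinner z (C (h - D g))"
        using C[of "h - D g" "z"] cinner_commute[of z] cinner_commute[of "C' z"]
        by (simp add: cinner_diff_left)
      moreover have "cinner k g = cinner f (D g) + cinner t (A' g)"
        using that by (simp add: cinner_add_left D A)
      ultimately show ?thesis by simp
    qed
    have "(g, h) \<in> adjoint_rel Q \<longleftrightarrow> (A' g, C (h - D g)) \<in> adjoint_rel R"
    proof
      assume gh: "(g, h) \<in> adjoint_rel Q"
      show "(A' g, C (h - D g)) \<in> adjoint_rel R"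
        unfolding mem_adjoint_rel_iff
      proof (intro allI impI)
        fix z t assume "(z, t) \<in> R"
        then have "(C' z, A t + D (C' z)) \<in> Q" by (auto simp: Q_def A'C')
        then have "cinner (A t + D (C' z)) g = cinner (C' z) h"
          by (rule adjoint_relD[OF gh])
        then show "cinner t (A' g) = cinner z (C (h - D g))"
          using step[of z "C' z" "A t + D (C' z)" t] by (simp add: A'C')
      qed
    next
      assume gh: "(A' g, C (h - D g)) \<in> adjoint_rel R"
      show "(g, h) \<in> adjoint_rel Q"
        unfolding mem_adjoint_rel_iff
      proof (intro allI impI)
        fix f k assume "(f, k) \<in> Q"
        then obtain t where "(A' f, t) \<in> R" "k = A t + D f" by (auto simp: Q_def)
        then show "cinner k g = cinner f h"
          using adjoint_relD[OF gh] step by blast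
      qed
    qed
    then show ?thesis by (simp add: R mem)
  qed
  then show ?thesis by auto
qed

section \<open>Passing between operators and their graphs\<close>

lemma csubspace_graph: "linear_operator S \<Longrightarrow> csubspace (Map.graph S)"
proof (rule csubspaceI)
  assume S: "linear_operator S"
  note lin = S[unfolded linear_operator_def]
  show add: "p + q \<in> Map.graph S" if "p \<in> Map.graph S" "q \<in> Map.graph S" for p q
  proof -
    obtain f k g l where "p = (f, k)" "q = (g, l)" by (cases p, cases q)
    with that have pq: "p = (f, k)" "q = (g, l)" "S f = Some k" "S g = Some l"
      by (auto simp: Map.graph_def)
    then have fg: "f \<in> dom S" "g \<in> dom S" by auto
    then have "f + g \<in> dom S" using lin complex_vector.subspace_add by blast
    moreover have "the (S (f + g)) = k + l" using lin fg pq by simp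
    ultimately show ?thesis using pq by (auto simp: Map.graph_def)
  qed
  show scale: "c *\<^sub>C p \<in> Map.graph S" if "p \<in> Map.graph S" for p c
  proof -
    obtain f k where "p = (f, k)" by (cases p)
    with that have p: "p = (f, k)" "S f = Some k" by (auto simp: Map.graph_def)
    then have f: "f \<in> dom S" by auto
    then have "c *\<^sub>C f \<in> dom S" using lin complex_vector.subspace_scale by blast
    moreover have "the (S (c *\<^sub>C f)) = c *\<^sub>C k" using lin f p by simp
    ultimately show ?thesis using p by (auto simp: Map.graph_def)
  qed
  have "0 \<in> dom S" using lin complex_vector.subspace_0 by blast
  then obtain k where "S 0 = Some k" by auto
  then show "0 \<in> Map.graph S"
    using scale[of "(0, k)" 0] by (simp add: Map.graph_def zero_prod_def)
qed

text \<open>Polarisation: the quadratic condition at \<open>f + g\<close> gives the imaginary part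
  of the identity, and replacing \<open>g\<close> by its multiple by \<open>\<i>\<close> gives the
  real part.\<close>

lemma symmetric_operator_graph:
  fixes S :: "'a::complex_inner \<rightharpoonup> 'a"
  assumes "symmetric_operator S"
  shows "Map.graph S \<subseteq> adjoint_rel (Map.graph S)"
proof -
  have S: "csubspace (Map.graph S)" using assms csubspace_graph by (auto simp: symmetric_operator_def)
  have Im: "Im (cinner k f) = 0" if "(f, k) \<in> Map.graph S" for f k
    using assms that by (force simp: symmetric_operator_def Map.graph_def)
  have Im2: "Im (cinner k g) + Im (cinner l f) = 0"
    if "(f, k) \<in> Map.graph S" "(g, l) \<in> Map.graph S" for f k g l
    using Im[of "f + g" "k + l"] Im[OF that(1)] Im[OF that(2)] complex_vector.subspace_add[OF S that]
    by (simp add: cinner_add_left cinner_add_right)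
  have "cinner k g = cinner f l" if fk: "(f, k) \<in> Map.graph S" and gl: "(g, l) \<in> Map.graph S" for f k g l
  proof (rule complex_eqI)
    show "Im (cinner k g) = Im (cinner f l)"
      using Im2[OF fk gl] cinner_commute[of f l] by simp
    have "(\<i> *\<^sub>C g, \<i> *\<^sub>C l) \<in> Map.graph S"
      using complex_vector.subspace_scale[OF S gl] by simp
    then show "Re (cinner k g) = Re (cinner f l)"
      using Im2[OF fk, of "\<i> *\<^sub>C g" "\<i> *\<^sub>C l"] cinner_commute[of f l]
      by (simp add: cinner_scaleC_left cinner_scaleC_right)
  qed
  then show ?thesis by (auto simp: mem_adjoint_rel_iff)
qed

text \<open>A vector \<open>y\<close> orthogonal to the domain satisfies
  \<open>(0, y) \<in> adjoint_rel R\<close>. For selfadjoint \<open>R\<close>, single-valuedness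
  therefore already forces a dense domain.\<close>

lemma selfadjoint_rel_operator:
  fixes R :: "('a::complex_hilbert_space \<times> 'a) set"
  assumes R: "adjoint_rel R = R" and single: "\<And>h. (0, h) \<in> R \<Longrightarrow> h = 0"
  shows "\<exists>T. Map.graph T = R \<and> selfadjoint_operator T"
proof -
  have sub: "csubspace R" using csubspace_adjoint_rel[of R] R by simp
  have uniq: "h = h'" if "(g, h) \<in> R" "(g, h') \<in> R" for g h h'
    using complex_vector.subspace_diff[OF sub that] single[of "h - h'"] by simp
  define T where "T g = (if \<exists>h. (g, h) \<in> R then Some (THE h. (g, h) \<in> R) else None)" for g
  have TR: "T g = Some h \<longleftrightarrow> (g, h) \<in> R" for g h
  proof -
    have "(THE h. (g, h) \<in> R) = h" if "(g, h) \<in> R" for h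
      using that uniq by blast
    then show ?thesis by (auto simp: T_def)
  qed
  have graph: "Map.graph T = R" by (auto simp: Map.graph_def TR)
  have the: "(f, the (T f)) \<in> R" if "f \<in> dom T" for f using that by (auto simp flip: TR)
  have domI: "f \<in> dom T" if "(f, k) \<in> R" for f k using that TR by (auto simp: dom_def)
  have lin: "linear_operator T"
    unfolding linear_operator_def
  proof (intro conjI ballI allI)
    show "csubspace (dom T)"
    proof (rule csubspaceI)
      show "0 \<in> dom T" using domI[of 0 0] complex_vector.subspace_0[OF sub] by (simp add: zero_prod_def)
      show "x + y \<in> dom T" if "x \<in> dom T" "y \<in> dom T" for x y
        using complex_vector.subspace_add[OF sub the[OF that(1)] the[OF that(2)]] domI by simp
      show "c *\<^sub>C x \<in> dom T" if "x \<in> dom T" for c x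
        using complex_vector.subspace_scale[OF sub the[OF that], of c] by (simp add: domI)
    qed
    show "the (T (f + g)) = the (T f) + the (T g)" if "f \<in> dom T" "g \<in> dom T" for f g
      using complex_vector.subspace_add[OF sub the[OF that(1)] the[OF that(2)]]
      by (simp flip: TR)
    show "the (T (c *\<^sub>C f)) = c *\<^sub>C the (T f)" if "f \<in> dom T" for c f
      using complex_vector.subspace_scale[OF sub the[OF that], of c] by (simp flip: TR)
  qed
  have "y = 0" if "y \<in> orth_compl (dom T)" for y
  proof (rule single)
    have "(0, y) \<in> adjoint_rel R"
      using that domI by (auto simp: mem_adjoint_rel_iff orth_compl_def)
    then show "(0, y) \<in> R" by (simp add: R)
  qed
  then have orth: "orth_compl (closure (dom T)) \<subseteq> {0}"
    unfolding orth_compl_closure by blast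
  have "x \<in> closure (dom T)" for x
  proof (rule orth_compl_orth_compl)
    show "x \<in> orth_compl (orth_compl (closure (dom T)))"
      unfolding orth_compl_def[of "orth_compl _"] using orth by auto
    show "csubspace (closure (dom T))"
      using lin unfolding linear_operator_def by (intro csubspace_closure) blast
  qed simp
  then have dense: "closure (dom T) = UNIV" by blast
  have "(\<forall>f\<in>dom T. cinner (the (T f)) g = cinner f h) \<longleftrightarrow> (g, h) \<in> R" for g h
  proof -
    have "(\<forall>f\<in>dom T. cinner (the (T f)) g = cinner f h) \<longleftrightarrow> (g, h) \<in> adjoint_rel R"
      unfolding mem_adjoint_rel_iff by (force simp flip: TR)
    then show ?thesis by (simp add: R)
  qed
  \<comment> \<open>The condition defining the adjoint is now membership in \<open>R\<close>, so
    both sides unfold to the same expression, including the case \<open>None\<close>.\<close>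
  then have "adjoint_operator T = T"
    by (intro ext) (simp add: adjoint_operator_def T_def)
  with lin dense have "selfadjoint_operator T" by (simp add: selfadjoint_operator_def)
  with graph show ?thesis by blast
qed

section \<open>Isometries onto subspaces\<close>

lemma csubspace_Times: "csubspace M \<Longrightarrow> csubspace N \<Longrightarrow> csubspace (M \<times> N)"
  by (rule csubspaceI)
    (auto simp: zero_prod_def complex_vector.subspace_0 complex_vector.subspace_add
      complex_vector.subspace_scale)

lemma csubspace_image:
  assumes V: "csubspace V" and add: "\<And>x y. f (x + y) = f x + f y"
    and scale: "\<And>c x. f (c *\<^sub>C x) = c *\<^sub>C f x"
  shows "csubspace (f ` V)"
proof (rule csubspaceI)
  have "f 0 = 0" using add[of 0 0] by simp
  then show "0 \<in> f ` V" using complex_vector.subspace_0[OF V] by force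
  show "x + y \<in> f ` V" if "x \<in> f ` V" "y \<in> f ` V" for x y
    using that complex_vector.subspace_add[OF V] by (auto simp flip: add)
  show "c *\<^sub>C x \<in> f ` V" if "x \<in> f ` V" for c x
    using that complex_vector.subspace_scale[OF V] by (auto simp flip: scale)
qed

lemma csubspace_fst_image: "csubspace V \<Longrightarrow> csubspace (fst ` V)"
  and csubspace_snd_image: "csubspace V \<Longrightarrow> csubspace (snd ` V)"
  by (simp_all add: csubspace_image scaleC_prod_def)

lemma sgn_scaleC: "sgn x = complex_of_real (inverse (norm x)) *\<^sub>C (x::'a::complex_inner)"
  by (simp add: sgn_div_norm scaleR_scaleC)

text \<open>Gram--Schmidt; a vector that depends linearly on its predecessors contributes a zero entry.\<close>

lemma orthonormal_basis_sequence:
  fixes M :: "'a::complex_hilbert_space set"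
  assumes M: "closed M" "csubspace M" and sep: "separable_space (euclidean :: 'a topology)"
  obtains e :: "nat \<Rightarrow> 'a"
  where "\<And>n. e n \<in> M" "\<And>m n. m \<noteq> n \<Longrightarrow> cinner (e m) (e n) = 0"
    "\<And>n. e n = 0 \<or> norm (e n) = 1"
    "\<And>x. x \<in> M \<Longrightarrow> (\<And>n. cinner x (e n) = 0) \<Longrightarrow> x = 0"
proof -
  obtain C :: "'a set" where C: "countable C" "closure C = UNIV"
    using sep unfolding separable_space_def by auto
  then have "C \<noteq> {}" by force
  \<comment> \<open>A vector of \<open>M\<close> orthogonal to every \<open>d n\<close> is
    orthogonal to the dense set \<open>C\<close>, hence zero.\<close>
  define d where "d n = orth_proj M (from_nat_into C n)" for n
  define L where "L n = closure (cspan (d ` {..<n}))" for n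
  define r where "r n = d n - orth_proj (L n) (d n)" for n
  define e where "e n = sgn (r n)" for n
  have L: "closed (L n)" "csubspace (L n)" for n
    by (simp_all add: L_def csubspace_closure complex_vector.subspace_span)
  have dM: "d n \<in> M" for n unfolding d_def by (rule orth_proj_in[OF M])
  have LM: "L n \<subseteq> M" for n
    unfolding L_def using dM by (intro closure_cspan_subset M) auto
  have Lmono: "L m \<subseteq> L n" if "m \<le> n" for m n
    unfolding L_def using that by (intro closure_mono complex_vector.span_mono) auto
  have dL: "d n \<in> L (Suc n)" for n
    unfolding L_def by (rule subsetD[OF closure_subset]) (simp add: complex_vector.span_base)
  have rL: "r n \<in> L (Suc n)" for n
    unfolding r_def using dL orth_proj_in[OF L] Lmono[of n "Suc n"] L(2)
    by (intro complex_vector.subspace_diff) auto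
  have eL: "e n \<in> L (Suc n)" for n
    unfolding e_def sgn_scaleC by (intro complex_vector.subspace_scale L rL)
  have eorth: "e n \<in> orth_compl (L n)" for n
    unfolding e_def sgn_scaleC r_def
    by (intro complex_vector.subspace_scale csubspace_orth_compl orth_proj_orth L)
  have orth_less: "cinner (e m) (e n) = 0" if "m < n" for m n
    using orth_complD[OF eorth] eL[of m] Lmono[of "Suc m" n] that by auto
  show thesis
  proof
    show "e n \<in> M" for n using eL LM by blast
    show "cinner (e m) (e n) = 0" if "m \<noteq> n" for m n
      using orth_less[of m n] orth_less[of n m] cinner_eq_0_commute[of "e m"] that
      by (cases "m < n") auto
    show "e n = 0 \<or> norm (e n) = 1" for n
      by (auto simp: e_def norm_sgn)
    show "x = 0" if x: "x \<in> M" "\<And>n. cinner x (e n) = 0" for x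
    proof -
      \<comment> \<open>Write \<open>d n\<close> as \<open>r n\<close> plus its projection onto
        \<open>L n\<close>: the first is a multiple of \<open>e n\<close>, the second is covered by
        the induction hypothesis.\<close>
      have "cinner x (d n) = 0" for n
      proof (induction n rule: less_induct)
        case (less n)
        have "L n \<subseteq> orth_compl {x}"
          unfolding L_def using less
          by (intro closure_cspan_subset closed_orth_compl csubspace_orth_compl)
            (auto simp: orth_compl_def)
        then have "cinner x (orth_proj (L n) (d n)) = 0"
          using orth_proj_in[OF L, of n "d n"] by (auto simp: orth_compl_def)
        moreover have "r n = complex_of_real (norm (r n)) *\<^sub>C e n"
          by (cases "r n = 0")
            (simp_all add: e_def sgn_div_norm flip: scaleR_scaleC)
        then have "cinner x (r n) = 0" by (metis cinner_scaleC_right mult_zero_right x(2))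
        ultimately show ?case by (simp add: r_def cinner_diff_right)
      qed
      then have "cinner (from_nat_into C n) x = 0" for n
        using cinner_orth_proj_left[OF M x(1), of "from_nat_into C n"] cinner_eq_0_commute
        unfolding d_def by metis
      then have "cinner x (from_nat_into C n) = 0" for n
        by (subst cinner_eq_0_commute)
      then have mem: "from_nat_into C n \<in> orth_compl {x}" for n
        by (simp add: orth_compl_def)
      have "C \<subseteq> orth_compl {x}"
      proof
        fix c assume "c \<in> C"
        then obtain n where "from_nat_into C n = c" using from_nat_into_surj[OF C(1)] by blast
        with mem[of n] show "c \<in> orth_compl {x}" by simp
      qed
      then have "closure C \<subseteq> orth_compl {x}" by (intro closure_minimal closed_orth_compl)
      then have "x \<in> orth_compl {x}" using C(2) by blast
      then show ?thesis by (simp add: orth_compl_def)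
    qed
  qed
qed

text \<open>The sequence is chosen recursively. If no further vector could be chosen, every
  \<open>x\<close> in \<open>N\<close> would equal its Fourier sum \<open>s\<close> over the
  finitely many vectors found so far, making \<open>N\<close> finite-dimensional.\<close>

lemma orthonormal_sequence_exists:
  fixes N :: "'a::complex_inner set"
  assumes N: "csubspace N" and inf: "\<not> finite_cdim N"
  obtains f :: "nat \<Rightarrow> 'a"
  where "\<And>n. f n \<in> N" "\<And>n. norm (f n) = 1" "\<And>m n. m \<noteq> n \<Longrightarrow> cinner (f m) (f n) = 0"
proof -
  define P where "P f n r \<longleftrightarrow> r \<in> N \<and> norm r = 1 \<and> (\<forall>m<n. cinner r (f m) = 0)"
    for f :: "nat \<Rightarrow> 'a" and n r
  have "\<exists>f. \<forall>n. P f n (f n)"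
  proof (rule dependent_wellorder_choice)
    show "P f n r = P g n r" if "\<And>m. m < n \<Longrightarrow> f m = g m" for r f g n
      using that by (auto simp: P_def)
    show "\<exists>r. P f n r" if f: "\<And>m. m < n \<Longrightarrow> P f m (f m)" for n f
    proof (rule ccontr)
      assume none: "\<nexists>r. P f n r"
      have orth: "cinner (f i) (f j) = (if i = j then 1 else 0)" if "i < n" "j < n" for i j
      proof (cases i j rule: linorder_cases)
        case less
        then show ?thesis using f[OF that(2)] cinner_eq_0_commute[of "f i"] by (auto simp: P_def)
      next
        case equal
        then show ?thesis using f[OF that(2)] by (auto simp: P_def cinner_self)
      next
        case greater
        then show ?thesis using f[OF that(1)] by (auto simp: P_def)
      qed
      have "x \<in> cspan (f ` {..<n})" if x: "x \<in> N" for x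
      proof -
        define s where "s = (\<Sum>m<n. cinner x (f m) *\<^sub>C f m)"
        have "s \<in> N"
          unfolding s_def using f N
          by (auto intro!: complex_vector.subspace_sum complex_vector.subspace_scale simp: P_def)
        then have z: "x - s \<in> N" using x N by (rule_tac complex_vector.subspace_diff)
        have zf: "cinner (x - s) (f j) = 0" if "j < n" for j
        proof -
          have "cinner s (f j) = (\<Sum>m<n. cinner (cinner x (f m) *\<^sub>C f m) (f j))"
            unfolding s_def
            by (rule bounded_bilinear.sum_left[OF bounded_bilinear_cinner])
          also have "\<dots> = (\<Sum>m<n. if m = j then cinner x (f j) else 0)"
            using that by (intro sum.cong) (auto simp: cinner_scaleC_left orth)
          also have "\<dots> = cinner x (f j)" using that by simp
          finally show ?thesis by (simp add: cinner_diff_left)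
        qed
        have "x = s"
        proof (rule ccontr)
          assume "x \<noteq> s"
          then have "P f n (sgn (x - s))"
            unfolding P_def using complex_vector.subspace_scale[OF N z] zf
            by (auto simp: norm_sgn sgn_scaleC[of "x - s"] cinner_scaleC_left norm_scaleC
                norm_inverse)
          then show False using none by blast
        qed
        moreover have "s \<in> cspan (f ` {..<n})"
          unfolding s_def
          by (intro complex_vector.span_sum complex_vector.span_scale complex_vector.span_base)
            simp
        ultimately show ?thesis by simp
      qed
      then have "finite_cdim N"
        unfolding finite_cdim_def by (intro exI[of _ "f ` {..<n}"]) auto
      with inf show False ..
    qed
  qed
  then obtain f where f: "\<And>n. P f n (f n)" by blast
  show thesis
  proof
    show "f n \<in> N" "norm (f n) = 1" for n using f[of n] by (auto simp: P_def)
    show "cinner (f m) (f n) = 0" if "m \<noteq> n" for m n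
      using that f[of n] f[of m] cinner_eq_0_commute[of "f m" "f n"]
      by (cases "m < n") (auto simp: P_def)
  qed
qed

text \<open>The isometry matches an orthonormal basis of \<open>M\<close> with an orthonormal
  sequence in \<open>N\<close>. Taking its graph \<open>V\<close> as a closed span replaces the
  extension of a map by continuity.\<close>

lemma isometric_graph_exists:
  fixes M :: "'a::complex_hilbert_space set" and N :: "'b::complex_hilbert_space set"
  assumes M: "closed M" "csubspace M" and N: "closed N" "csubspace N"
    and sep: "separable_space (euclidean :: 'a topology)" and inf: "\<not> finite_cdim N"
  obtains V :: "('a \<times> 'b) set"
  where "csubspace V" "fst ` V = M" "snd ` V \<subseteq> N" "closed (snd ` V)"
    "\<And>p q. p \<in> V \<Longrightarrow> q \<in> V \<Longrightarrow> cinner (snd p) (snd q) = cinner (fst p) (fst q)"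
proof -
  obtain e :: "nat \<Rightarrow> 'a" where e: "\<And>n. e n \<in> M" "\<And>m n. m \<noteq> n \<Longrightarrow> cinner (e m) (e n) = 0"
    "\<And>n. e n = 0 \<or> norm (e n) = 1"
    and complete: "\<And>x. x \<in> M \<Longrightarrow> (\<And>n. cinner x (e n) = 0) \<Longrightarrow> x = 0"
    using orthonormal_basis_sequence[OF M sep] by blast
  obtain f :: "nat \<Rightarrow> 'b" where f: "\<And>n. f n \<in> N" "\<And>n. norm (f n) = 1"
    "\<And>m n. m \<noteq> n \<Longrightarrow> cinner (f m) (f n) = 0"
    using orthonormal_sequence_exists[OF N(2) inf] by blast
  \<comment> \<open>Zero entries of \<open>e\<close> are left out, since a pair
    \<open>(0, f n)\<close> would violate isometry.\<close>
  define E where "E = {(e n, f n) |n. e n \<noteq> 0}"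
  define V where "V = closure (cspan E)"
  have V: "csubspace V" "closed V"
    by (simp_all add: V_def csubspace_closure complex_vector.subspace_span)
  have EV: "E \<subseteq> V"
    unfolding V_def using closure_subset complex_vector.span_superset by blast
  have VMN: "V \<subseteq> M \<times> N"
    unfolding V_def using e f by (intro closure_cspan_subset closed_Times csubspace_Times M N)
      (auto simp: E_def)
  \<comment> \<open>Each \<open>B q\<close> is a closed subspace and membership is symmetric in
    \<open>p\<close> and \<open>q\<close>, so the identity extends from \<open>E\<close> to
    \<open>V\<close> one argument at a time.\<close>
  define B where "B q = {p :: 'a \<times> 'b. cinner (snd p) (snd q) = cinner (fst p) (fst q)}" for q
  have B: "closed (B q)" "csubspace (B q)" for q
  proof -
    show "closed (B q)"
      unfolding B_def by (intro closed_Collect_eq continuous_intros)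
    show "csubspace (B q)"
      by (rule csubspaceI) (auto simp: B_def cinner_add_left cinner_scaleC_left scaleC_prod_def)
  qed
  have B_sym: "p \<in> B q \<longleftrightarrow> q \<in> B p" for p q
    unfolding B_def using cinner_commute by (metis (mono_tags, lifting) mem_Collect_eq)
  have "E \<subseteq> B q" if "q \<in> E" for q
  proof -
    have "cinner (f m) (f n) = cinner (e m) (e n)" if "e m \<noteq> 0" for m n
      using that e(2,3)[of m] f(2,3)[of m] by (cases "m = n") (auto simp: cinner_self)
    then show ?thesis using that by (auto simp: E_def B_def)
  qed
  then have "V \<subseteq> B q" if "q \<in> E" for q
    unfolding V_def using that by (intro closure_cspan_subset B) auto
  then have "E \<subseteq> B p" if "p \<in> V" for p
    using that B_sym by blast
  then have VB: "V \<subseteq> B p" if "p \<in> V" for p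
    unfolding V_def using that by (intro closure_cspan_subset B) (auto simp: V_def)
  have norm_eq: "norm (snd p) = norm (fst p)" if "p \<in> V" for p
  proof -
    have "cinner (snd p) (snd p) = cinner (fst p) (fst p)"
      using VB[OF that] that by (auto simp: B_def)
    then have "(norm (snd p))\<^sup>2 = (norm (fst p))\<^sup>2" unfolding cinner_self of_real_eq_iff .
    then show ?thesis by simp
  qed
  have norm_le: "norm p \<le> norm (fst p) + norm (snd p)" for p :: "'a \<times> 'b"
    using norm_Pair_le[of "fst p" "snd p"] by simp
  have complete_V: "complete V" using V(2) by (simp add: complete_eq_closed)
  have closed_fst: "closed (fst ` V)"
    unfolding complete_eq_closed[symmetric]
  \<comment> \<open>Both components of \<open>p\<close> have equal norm, so \<open>norm p\<close> is
    at most twice the norm of either one.\<close>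
  proof (rule complete_isometric_image[of "1/2"])
    show "\<forall>p\<in>V. 1/2 * norm p \<le> norm (fst p)"
    proof
      show "1/2 * norm p \<le> norm (fst p)" if "p \<in> V" for p
        using norm_le[of p] norm_eq[OF that] by simp
    qed
  qed (simp_all add: V csubspace_imp_subspace complete_V bounded_linear_fst)
  have "x \<in> fst ` V" if x: "x \<in> M" for x
  proof -
    note F = closed_fst csubspace_fst_image[OF V(1)]
    let ?q = "orth_proj (fst ` V) x"
    have "?q \<in> M" using orth_proj_in[OF F, of x] VMN by auto
    then have "x - ?q \<in> M" using x M(2) by (rule_tac complex_vector.subspace_diff)
    moreover have "cinner (x - ?q) (e n) = 0" for n
    proof (cases "e n = 0")
      case False
      then have "e n \<in> fst ` V" using EV by (force simp: E_def)
      then show ?thesis by (rule orth_complD'[OF orth_proj_orth[OF F]])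
    qed simp
    ultimately have "x - ?q = 0" by (rule complete)
    then show ?thesis using orth_proj_in[OF F, of x] by simp
  qed
  then have "fst ` V = M" using VMN by auto
  moreover have "closed (snd ` V)"
    unfolding complete_eq_closed[symmetric]
  proof (rule complete_isometric_image[of "1/2"])
    show "\<forall>p\<in>V. 1/2 * norm p \<le> norm (snd p)"
    proof
      show "1/2 * norm p \<le> norm (snd p)" if "p \<in> V" for p
        using norm_le[of p] norm_eq[OF that] by simp
    qed
  qed (simp_all add: V csubspace_imp_subspace complete_V bounded_linear_snd)
  moreover have "snd ` V \<subseteq> N" using VMN by auto
  moreover have "cinner (snd p) (snd q) = cinner (fst p) (fst q)" if "p \<in> V" "q \<in> V" for p q
    using VB[OF that(2)] that(1) by (auto simp: B_def)
  ultimately show thesis using that V(1) by blast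
qed

section \<open>Coupling a symmetric relation to a copy of its negative\<close>

text \<open>A closed relation in \<open>M\<close> equals its biadjoint formed in \<open>M\<close>.
  The component \<open>(r1, r2)\<close> of \<open>(x, c)\<close> orthogonal to \<open>R\<close>
  yields the element \<open>(r2, - r1)\<close> of the adjoint; testing \<open>(x, c)\<close> against
  it shows \<open>(r1, r2)\<close> orthogonal to \<open>(x, c)\<close>, hence zero.\<close>

lemma biadjoint_within:
  fixes R :: "('a::complex_hilbert_space \<times> 'a) set"
  assumes R: "closed R" "csubspace R" "R \<subseteq> M \<times> M" and M: "csubspace M"
    and xc: "(x, c) \<in> adjoint_rel (adjoint_rel R \<inter> M \<times> M)" "x \<in> M" "c \<in> M"
  shows "(x, c) \<in> R"
proof -
  define q where "q = orth_proj R (x, c)"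
  have q: "q \<in> R" "(x, c) - q \<in> orth_compl R"
    unfolding q_def by (rule orth_proj_in[OF R(1,2)], rule orth_proj_orth[OF R(1,2)])
  obtain r1 r2 where r: "(x, c) - q = (r1, r2)" by fastforce
  have "q \<in> M \<times> M" using q R(3) by blast
  then have rM: "r1 \<in> M" "r2 \<in> M"
    using r xc M by (auto simp: complex_vector.subspace_diff prod_eq_iff)
  have "(r2, - r1) \<in> adjoint_rel R"
    unfolding mem_adjoint_rel_iff
    using q(2) unfolding r by (auto simp: orth_compl_def add_eq_0_iff2)
  then have "cinner (- r1) x = cinner r2 c"
    using adjoint_relD[OF xc(1), of r2 "- r1"] rM M by (simp add: csubspace_neg)
  then have "cinner r2 c = - cinner r1 x" by simp
  then have "cinner (r1, r2) (x, c) = 0" by simp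
  moreover have "cinner (r1, r2) q = 0" using orth_complD'[OF q(2) q(1)] by (simp add: r)
  ultimately have "cinner (r1, r2) ((x, c) - q) = 0" by (simp only: cinner_diff_right) simp
  then have "(r1, r2) = 0" unfolding r by (simp only: cinner_eq_zero_iff)
  then show ?thesis using q(1) r by simp
qed

text \<open>With \<open>B\<close> the operator of \<open>R\<close> in \<open>M\<close> and \<open>V : M \<rightarrow> M\<^sup>\<bottom>\<close> the isometry with graph \<open>V\<close>, this is the
  selfadjoint extension of \<open>B \<oplus> (- V B V\<^sup>*) \<oplus> 0\<close> with domain
  \<open>{x + V y + n. x, y \<in> dom B\<^sup>*, x - y \<in> dom B}\<close>; below, \<open>u = x - y\<close>.\<close>

definition coupled_rel ::
    "'a::complex_inner set \<Rightarrow> ('a \<times> 'a) set \<Rightarrow> ('a \<times> 'a) set \<Rightarrow> ('a \<times> 'a) set"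
  where "coupled_rel M R V = {(u + y + v + n, b + k - l) | u b y k v l n.
    (u, b) \<in> R \<and> (y, k) \<in> adjoint_rel R \<inter> M \<times> M \<and> (y, v) \<in> V \<and> (k, l) \<in> V \<and>
    n \<in> orth_compl M \<inter> orth_compl (snd ` V)}"

context
  fixes M :: "'a::complex_hilbert_space set" and R V :: "('a \<times> 'a) set"
  assumes M: "closed M" "csubspace M"
    and R: "closed R" "csubspace R" "R \<subseteq> M \<times> M" "R \<subseteq> adjoint_rel R"
    and V: "csubspace V" "fst ` V = M" "snd ` V \<subseteq> orth_compl M" "closed (snd ` V)"
    and isom: "\<And>p q. p \<in> V \<Longrightarrow> q \<in> V \<Longrightarrow> cinner (snd p) (snd q) = cinner (fst p) (fst q)"
begin

private lemma isomD: "(x, v) \<in> V \<Longrightarrow> (y, w) \<in> V \<Longrightarrow> cinner v w = cinner x y"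
  using isom by fastforce

private lemma zero_in: "(0, 0) \<in> R" "(0, 0) \<in> V" "(0, 0) \<in> adjoint_rel R"
  using complex_vector.subspace_0[OF R(2)] complex_vector.subspace_0[OF V(1)]
    complex_vector.subspace_0[OF csubspace_adjoint_rel[of R]] by (simp_all add: zero_prod_def)

private lemma zero_orth: "0 \<in> orth_compl A"
  by (simp add: orth_compl_def)

private lemma M0: "0 \<in> M"
  using M(2) complex_vector.subspace_0 by blast

lemma coupled_relI:
  assumes "(u, b) \<in> R" "(y, k) \<in> adjoint_rel R" "y \<in> M" "k \<in> M" "(y, v) \<in> V" "(k, l) \<in> V"
    "n \<in> orth_compl M" "n \<in> orth_compl (snd ` V)"
  shows "(u + y + v + n, b + k - l) \<in> coupled_rel M R V"
  unfolding coupled_rel_def using assms by blast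

lemma subset_coupled_rel: "R \<subseteq> coupled_rel M R V"
proof
  fix p assume "p \<in> R"
  then show "p \<in> coupled_rel M R V"
    using coupled_relI[of "fst p" "snd p" 0 0 0 0 0] by (simp add: zero_in zero_orth M0)
qed

text \<open>The pairing of two adjoint elements, which symmetry of \<open>R\<close> does not
  control, is cancelled by its isometric copy; hence the minus sign at \<open>l\<close>. The
  remaining terms match by symmetry of \<open>R\<close> and by the duality between \<open>R\<close>
  and its adjoint.\<close>

lemma coupled_rel_symmetric: "coupled_rel M R V \<subseteq> adjoint_rel (coupled_rel M R V)"
proof -
  have key: "cinner (b + k - l) (u' + y' + v' + n') = cinner (u + y + v + n) (b' + k' - l')"
    if "(u, b) \<in> R" "(y, k) \<in> adjoint_rel R \<inter> M \<times> M" "(y, v) \<in> V" "(k, l) \<in> V"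
      "n \<in> orth_compl M \<inter> orth_compl (snd ` V)"
      "(u', b') \<in> R" "(y', k') \<in> adjoint_rel R \<inter> M \<times> M" "(y', v') \<in> V" "(k', l') \<in> V"
      "n' \<in> orth_compl M \<inter> orth_compl (snd ` V)"
    for u b y k v l n u' b' y' k' v' l' n'
  proof -
    have inM: "u \<in> M" "b \<in> M" "y \<in> M" "k \<in> M" "u' \<in> M" "b' \<in> M" "y' \<in> M" "k' \<in> M"
      using that R(3) by auto
    have inV: "v \<in> snd ` V" "l \<in> snd ` V" "v' \<in> snd ` V" "l' \<in> snd ` V"
      using that by force+
    then have inMo: "v \<in> orth_compl M" "l \<in> orth_compl M" "v' \<in> orth_compl M" "l' \<in> orth_compl M"
      using V(3) by auto
    have "cinner (b + k - l) (u' + y' + v' + n') =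
        cinner b u' + cinner b y' + cinner k u' + cinner k y' - cinner l v'"
      using inM inV inMo that
      by (simp add: cinner_add_left cinner_add_right cinner_diff_left orth_complD[of _ M]
          orth_complD'[of _ M] orth_complD[of _ "snd ` V"])
    moreover have "cinner (u + y + v + n) (b' + k' - l') =
        cinner u b' + cinner y b' + cinner u k' + cinner y k' - cinner v l'"
      using inM inV inMo that
      by (simp add: cinner_add_left cinner_add_right cinner_diff_right orth_complD[of _ M]
          orth_complD'[of _ M] orth_complD'[of _ "snd ` V"])
    moreover have "cinner l v' = cinner k y'" "cinner v l' = cinner y k'"
      using that isomD by blast+
    moreover have "cinner b u' = cinner u b'"
      using that R(4) adjoint_relD[of u' b' R u b] by blast
    moreover have "cinner b y' = cinner u k'"
      using that adjoint_relD[of y' k' R u b] by blast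
    moreover have "cinner k u' = cinner y b'"
      using that adjoint_relD'[of y k R u' b'] by (metis IntD1 cinner_commute)
    ultimately show ?thesis by simp
  qed
  have "cinner k g = cinner f h"
    if fk: "(f, k) \<in> coupled_rel M R V" and gh: "(g, h) \<in> coupled_rel M R V" for f k g h
  proof -
    obtain u b y k0 v l n where 1: "(u, b) \<in> R" "(y, k0) \<in> adjoint_rel R \<inter> M \<times> M" "(y, v) \<in> V"
      "(k0, l) \<in> V" "n \<in> orth_compl M \<inter> orth_compl (snd ` V)"
      and eq1: "f = u + y + v + n" "k = b + k0 - l"
      using fk unfolding coupled_rel_def by blast
    obtain u' b' y' k' v' l' n' where 2: "(u', b') \<in> R" "(y', k') \<in> adjoint_rel R \<inter> M \<times> M"
      "(y', v') \<in> V" "(k', l') \<in> V" "n' \<in> orth_compl M \<inter> orth_compl (snd ` V)"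
      and eq2: "g = u' + y' + v' + n'" "h = b' + k' - l'"
      using gh unfolding coupled_rel_def by blast
    show ?thesis unfolding eq1 eq2 by (rule key[OF 1 2])
  qed
  then show ?thesis by (auto simp: mem_adjoint_rel_iff)
qed

text \<open>Split \<open>g\<close> and \<open>h\<close> along \<open>M\<close>, the range of
  \<open>V\<close> and the rest. Testing with \<open>(m, 0)\<close> removes the rest of
  \<open>h\<close>, testing with \<open>R\<close> puts the \<open>M\<close>-components into the
  adjoint of \<open>R\<close>, and testing with pairs \<open>(y + v, k - l)\<close> puts
  \<open>(g0 - y', h0 + c)\<close> into the biadjoint, which is \<open>R\<close>.\<close>

lemma coupled_rel_selfadjoint: "adjoint_rel (coupled_rel M R V) = coupled_rel M R V"
proof (intro subset_antisym coupled_rel_symmetric subsetI)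
  let ?W = "snd ` V" and ?A = "adjoint_rel R \<inter> M \<times> M"
  note W = V(4) csubspace_snd_image[OF V(1)]
  have decomp: "\<exists>x c v n. x \<in> M \<and> (c, v) \<in> V \<and> n \<in> orth_compl M \<and> n \<in> orth_compl ?W \<and> g = x + v + n"
    for g
  proof -
    let ?g1 = "g - orth_proj M g"
    have "orth_proj ?W ?g1 \<in> ?W" by (rule orth_proj_in[OF W])
    then obtain c where c: "(c, orth_proj ?W ?g1) \<in> V" by force
    have "orth_proj ?W ?g1 \<in> orth_compl M" using orth_proj_in[OF W] V(3) by blast
    then have "?g1 - orth_proj ?W ?g1 \<in> orth_compl M"
      by (intro complex_vector.subspace_diff csubspace_orth_compl orth_proj_orth M)
    moreover have "?g1 - orth_proj ?W ?g1 \<in> orth_compl ?W" by (rule orth_proj_orth[OF W])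
    moreover have "g = orth_proj M g + orth_proj ?W ?g1 + (?g1 - orth_proj ?W ?g1)" by simp
    ultimately show ?thesis using c orth_proj_in[OF M] by blast
  qed
  fix p assume "p \<in> adjoint_rel (coupled_rel M R V)"
  then obtain g h where p: "p = (g, h)" and gh: "(g, h) \<in> adjoint_rel (coupled_rel M R V)"
    by (cases p) auto
  obtain g0 y' v' n' where g: "g0 \<in> M" "(y', v') \<in> V" "n' \<in> orth_compl M" "n' \<in> orth_compl ?W"
    "g = g0 + v' + n'"
    using decomp by blast
  obtain h0 c l0 m where h: "h0 \<in> M" "(c, l0) \<in> V" "m \<in> orth_compl M" "m \<in> orth_compl ?W"
    "h = h0 + l0 + m"
    using decomp by blast
  have W': "v' \<in> ?W" "l0 \<in> ?W" using g h by force+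
  then have Mo: "v' \<in> orth_compl M" "l0 \<in> orth_compl M" using V(3) by auto
  have y'M: "y' \<in> M" and cM: "c \<in> M" using g(2) h(2) V(2) by force+
  have "(m, 0) \<in> coupled_rel M R V"
    using coupled_relI[of 0 0 0 0 0 0 m] h by (simp add: zero_in M0)
  then have "cinner 0 g = cinner m h" by (rule adjoint_relD[OF gh])
  then have "cinner m m = 0"
    using h W' by (simp add: cinner_add_right orth_complD'[of _ M] orth_complD'[of _ ?W])
  then have m: "m = 0" by simp
  have "(g0, h0) \<in> adjoint_rel R"
    unfolding mem_adjoint_rel_iff
  proof (intro allI impI)
    fix u b assume ub: "(u, b) \<in> R"
    then have "cinner b g = cinner u h" using adjoint_relD[OF gh] subset_coupled_rel by blast
    moreover have "u \<in> M" "b \<in> M" using ub R(3) by auto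
    ultimately show "cinner b g0 = cinner u h0"
      using g h m Mo by (simp add: cinner_add_right orth_complD[of _ M])
  qed
  have "(g0 - y', h0 + c) \<in> adjoint_rel ?A"
    unfolding mem_adjoint_rel_iff
  proof (intro allI impI)
    fix y k assume yk: "(y, k) \<in> ?A"
    then obtain v l where vl: "(y, v) \<in> V" "(k, l) \<in> V" using V(2) by force
    have vlo: "v \<in> orth_compl M" "l \<in> orth_compl M" "v \<in> ?W" "l \<in> ?W" using vl V(3) by force+
    have "(y + v, k - l) \<in> coupled_rel M R V"
      using coupled_relI[of 0 0 y k v l 0] yk vl by (simp add: zero_in zero_orth)
    then have "cinner (k - l) g = cinner (y + v) h" by (rule adjoint_relD[OF gh])
    then have "cinner k g0 - cinner l v' = cinner y h0 + cinner v l0"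
      using g h m Mo W' vlo yk
      by (simp add: cinner_add_left cinner_add_right cinner_diff_left orth_complD[of _ M]
          orth_complD'[of _ M] orth_complD[of _ ?W])
    then show "cinner k (g0 - y') = cinner y (h0 + c)"
      using isomD[OF vl(2) g(2)] isomD[OF vl(1) h(2)]
      by (simp add: cinner_diff_right cinner_add_right)
  qed
  then have ub: "(g0 - y', h0 + c) \<in> R"
    by (rule biadjoint_within[OF R(1,2,3) M(2)])
      (simp_all add: complex_vector.subspace_diff complex_vector.subspace_add M g h y'M cM)
  have "(g0, h0) - (g0 - y', h0 + c) \<in> adjoint_rel R"
    using \<open>(g0, h0) \<in> adjoint_rel R\<close> ub R(4)
    by (intro complex_vector.subspace_diff csubspace_adjoint_rel) auto
  then have "(y', - c) \<in> adjoint_rel R" by simp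
  moreover have "(- c, - l0) \<in> V" using csubspace_neg[OF V(1) h(2)] by simp
  \<comment> \<open>The representation has \<open>u = g0 - y'\<close>, \<open>b = h0 + c\<close>,
    \<open>k = - c\<close> and \<open>l = - l0\<close>.\<close>
  ultimately have "(g0 - y' + y' + v' + n', h0 + c + - c - - l0) \<in> coupled_rel M R V"
    using ub g y'M cM M(2) by (intro coupled_relI) (simp_all add: csubspace_neg)
  then show "p \<in> coupled_rel M R V" using p g h m by simp
qed

text \<open>For \<open>z\<close> in \<open>M\<close> the part \<open>v + n\<close> vanishes, so
  \<open>v\<close> and with it \<open>y\<close> are zero. Then \<open>k\<close> is orthogonal to the
  domain of \<open>R\<close>, which is dense in \<open>M\<close>, and only the pair from
  \<open>R\<close> is left.\<close>

lemma coupled_rel_restrict: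
  assumes dense: "\<And>x. x \<in> M \<Longrightarrow> x \<in> orth_compl (fst ` R) \<Longrightarrow> x = 0"
    and zt: "(z, t) \<in> coupled_rel M R V" "z \<in> M"
  shows "(z, t) \<in> R"
proof -
  obtain u b y k v l n where
    ub: "(u, b) \<in> R" and yk: "(y, k) \<in> adjoint_rel R" "y \<in> M" "k \<in> M" and
    yv: "(y, v) \<in> V" and kl: "(k, l) \<in> V" and n: "n \<in> orth_compl M" "n \<in> orth_compl (snd ` V)" and
    z: "z = u + y + v + n" and t: "t = b + k - l"
    using zt(1) unfolding coupled_rel_def by blast
  have vW: "v \<in> snd ` V" using yv by force
  then have vM: "v \<in> orth_compl M" using V(3) by blast
  have "u \<in> M" using ub R(3) by blast
  then have "z - u - y \<in> M" using zt(2) yk M(2) by (intro complex_vector.subspace_diff)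
  then have "v + n \<in> M" by (simp add: z)
  moreover have "v + n \<in> orth_compl M"
    by (intro complex_vector.subspace_add csubspace_orth_compl vM n)
  ultimately have vn: "v + n = 0" by (rule orth_compl_Int)
  then have "cinner v (v + n) = 0" by simp
  then have "cinner v v = 0" using orth_complD[OF n(2) vW] by (simp add: cinner_add_right)
  then have "v = 0" "y = 0" using isomD[OF yv yv] by simp_all
  then have "n = 0" using vn by simp
  have "k \<in> orth_compl (fst ` R)"
    using yk(1) \<open>y = 0\<close> by (force simp: orth_compl_def mem_adjoint_rel_iff)
  then have "k = 0" using dense yk(3) by blast
  then have "l = 0" using isomD[OF kl kl] by simp
  show ?thesis
    using ub by (simp add: z t \<open>v = 0\<close> \<open>y = 0\<close> \<open>n = 0\<close> \<open>k = 0\<close> \<open>l = 0\<close>)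
qed

end

section \<open>The projected operator\<close>

lemma mem_graph_iff: "(f, k) \<in> Map.graph S \<longleftrightarrow> S f = Some k"
  by (simp add: Map.graph_def)

lemma dom_projected_operator [simp]: "dom (projected_operator S) = dom S"
  by (auto simp: projected_operator_def dom_def)

lemma projected_operator_Some:
  "S f = Some s \<Longrightarrow> projected_operator S f = Some (orth_proj (dom_closure S) s)"
  by (simp add: projected_operator_def)

lemma closed_csubspace_dom_closure:
  "linear_operator S \<Longrightarrow> closed (dom_closure S)" "linear_operator S \<Longrightarrow> csubspace (dom_closure S)"
  by (simp_all add: dom_closure_def csubspace_closure linear_operator_def)

text \<open>This subsumes the case of \<open>projected_operator S\<close> itself under that of
  closed symmetric extensions; its closedness is regularity.\<close>

lemma projected_operator_extends_itself:
  fixes S :: "'a::complex_hilbert_space \<rightharpoonup> 'a"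
  assumes S: "symmetric_operator S" and reg: "regular_operator S"
  shows "closed_symmetric_extension_in (dom_closure S) (projected_operator S) (projected_operator S)"
proof -
  let ?M = "dom_closure S" and ?S0 = "projected_operator S"
  have lin: "linear_operator S" using S by (simp add: symmetric_operator_def)
  note M = closed_csubspace_dom_closure[OF lin]
  have dM: "dom S \<subseteq> ?M" by (simp add: dom_closure_def closure_subset)
  have the: "the (?S0 f) = orth_proj ?M (the (S f))" if "f \<in> dom S" for f
    using that by (auto simp: projected_operator_Some)
  have "linear_operator ?S0"
    using lin complex_vector.subspace_add[of "dom S"] complex_vector.subspace_scale[of "dom S"]
    unfolding linear_operator_def dom_projected_operator
    by (simp add: the orth_proj_add[OF M] orth_proj_scaleC[OF M])
  moreover have "cinner (the (?S0 f)) f = cinner (the (S f)) f" if "f \<in> dom S" for f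
    using cinner_orth_proj_left[OF M, of f] that dM by (auto simp: the)
  then have "\<forall>f\<in>dom S. Im (cinner (the (?S0 f)) f) = 0"
    using S by (simp add: symmetric_operator_def)
  moreover have "ran ?S0 \<subseteq> ?M"
    by (auto simp: ran_def projected_operator_def orth_proj_in[OF M])
  ultimately show ?thesis
    using dM reg unfolding closed_symmetric_extension_in_def symmetric_operator_def regular_operator_def
    by simp
qed

text \<open>Regularity enters here: both \<open>S\<close> and \<open>S\<^sub>0\<close> are closed, so by the closed graph theorem the
  component \<open>S - S\<^sub>0\<close> of \<open>S\<close> is bounded in the graph norm of \<open>S\<^sub>0\<close>.\<close>

lemma regular_operator_component:
  fixes S :: "'a::complex_hilbert_space \<rightharpoonup> 'a"
  assumes lin: "linear_operator S" and cl: "closed_operator S" and reg: "regular_operator S"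
    and lin0: "linear_operator (projected_operator S)"
  obtains c :: "'a \<times> 'a \<Rightarrow> 'a" where
    "bounded_linear c" "\<And>a p. c (a *\<^sub>C p) = a *\<^sub>C c p"
    "\<And>p. c p \<in> orth_compl (dom_closure S)"
    "\<And>p. p \<in> orth_compl (dom_closure S) \<times> orth_compl (dom_closure S) \<Longrightarrow> c p = 0"
    "\<And>f s. S f = Some s \<Longrightarrow> s = orth_proj (dom_closure S) s + c (f, orth_proj (dom_closure S) s)"
proof -
  let ?M = "dom_closure S"
  define G where "G = Map.graph S"
  define G0 where "G0 = Map.graph (projected_operator S)"
  define \<pi> where "\<pi> = orth_proj G0"
  note M = closed_csubspace_dom_closure[OF lin]
  have G: "closed G" "csubspace G"
    using cl csubspace_graph[OF lin] by (simp_all add: G_def closed_operator_def)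
  have G0: "closed G0" "csubspace G0"
    using reg csubspace_graph[OF lin0]
    by (simp_all add: G0_def closed_operator_def regular_operator_def)
  have bl: "bounded_linear \<pi>" unfolding \<pi>_def by (rule bounded_linear_orth_proj[OF G0])
  \<comment> \<open>Projecting onto \<open>G0\<close> first makes the difference of \<open>S\<close>
    and its projected operator a map on all pairs.\<close>
  define c where "c p = the (S (fst (\<pi> p))) - snd (\<pi> p)" for p
  have \<pi>: "\<exists>s. S (fst (\<pi> p)) = Some s \<and> snd (\<pi> p) = orth_proj ?M s" for p
  proof -
    have "\<pi> p \<in> G0" unfolding \<pi>_def by (rule orth_proj_in[OF G0])
    then show ?thesis
      by (cases "\<pi> p") (auto simp: G0_def mem_graph_iff projected_operator_def)
  qed
  \<comment> \<open>Being determined by membership in \<open>G\<close>, the map \<open>c\<close>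
    inherits linearity from \<open>G\<close>, and its graph is a continuous preimage of
    \<open>G\<close>.\<close>
  have c_iff: "(fst (\<pi> p), snd (\<pi> p) + x) \<in> G \<longleftrightarrow> x = c p" for p x
    using \<pi>[of p] by (auto simp: G_def mem_graph_iff c_def eq_diff_eq add.commute)
  have add: "c (p + q) = c p + c q" for p q
  proof -
    have "(fst (\<pi> p), snd (\<pi> p) + c p) + (fst (\<pi> q), snd (\<pi> q) + c q) \<in> G"
      by (intro complex_vector.subspace_add G) (simp_all add: c_iff)
    moreover have "\<pi> (p + q) = \<pi> p + \<pi> q" unfolding \<pi>_def by (rule orth_proj_add[OF G0])
    ultimately have "(fst (\<pi> (p + q)), snd (\<pi> (p + q)) + (c p + c q)) \<in> G"
      by (simp add: algebra_simps)
    then show ?thesis unfolding c_iff by simp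
  qed
  have scale: "c (a *\<^sub>C p) = a *\<^sub>C c p" for a p
  proof -
    have "a *\<^sub>C (fst (\<pi> p), snd (\<pi> p) + c p) \<in> G"
      by (intro complex_vector.subspace_scale G) (simp add: c_iff)
    moreover have "\<pi> (a *\<^sub>C p) = a *\<^sub>C \<pi> p" unfolding \<pi>_def by (rule orth_proj_scaleC[OF G0])
    ultimately have "(fst (\<pi> (a *\<^sub>C p)), snd (\<pi> (a *\<^sub>C p)) + a *\<^sub>C c p) \<in> G"
      by (simp add: scaleC_prod_def scaleC_add_right)
    then show ?thesis unfolding c_iff by simp
  qed
  have "bounded_linear c"
  proof (rule closed_graph_theorem)
    show "linear c" by (rule linearI) (simp_all add: add scale scaleR_scaleC)
    have "{(p, c p) |p. True} = (\<lambda>q. (fst (\<pi> (fst q)), snd (\<pi> (fst q)) + snd q)) -` G"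
      by (auto simp: c_iff)
    moreover have "continuous_on UNIV (\<lambda>q :: ('a \<times> 'a) \<times> 'a. \<pi> (fst q))"
      by (intro bounded_linear.continuous_on[OF bl] continuous_intros)
    ultimately show "closed {(p, c p) |p. True}"
      by (auto intro!: closed_vimage G continuous_intros)
  qed
  moreover have "c p \<in> orth_compl ?M" for p
    using \<pi>[of p] orth_proj_orth[OF M] by (auto simp: c_def)
  moreover have "c p = 0" if "p \<in> orth_compl ?M \<times> orth_compl ?M" for p
  proof -
    have "dom S \<subseteq> ?M" by (simp add: dom_closure_def closure_subset)
    then have "G0 \<subseteq> ?M \<times> ?M"
      using orth_proj_in[OF M] by (fastforce simp: G0_def mem_graph_iff projected_operator_def)
    then have "p \<in> orth_compl G0"
      using that by (auto simp: orth_compl_def cinner_prod_def)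
    then have "\<pi> p = 0" unfolding \<pi>_def by (rule orth_proj_orth_compl[OF G0])
    moreover have "0 \<in> G" using complex_vector.subspace_0[OF G(2)] .
    ultimately have "(fst (\<pi> p), snd (\<pi> p) + 0) \<in> G" by (simp add: zero_prod_def)
    then show ?thesis unfolding c_iff by simp
  qed
  moreover have "s = orth_proj ?M s + c (f, orth_proj ?M s)" if "S f = Some s" for f s
  proof -
    have "(f, orth_proj ?M s) \<in> G0"
      using that by (simp add: G0_def mem_graph_iff projected_operator_Some)
    then have "\<pi> (f, orth_proj ?M s) = (f, orth_proj ?M s)"
      unfolding \<pi>_def by (rule orth_proj_id[OF G0])
    then show ?thesis using that by (simp add: c_def)
  qed
  ultimately show thesis using that scale by blast
qed

section \<open>The selfadjoint extension and its compression\<close>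

theorem theorem6p4:
  fixes S S\<^sub>0' :: "'h::complex_hilbert_space \<rightharpoonup> 'h"
  assumes "\<not> finite_cdim (UNIV :: 'h set)"
    and "separable_space (euclidean :: 'h topology)"
    and "symmetric_operator S"
    and "closed_operator S"
    and "closure (dom S) \<noteq> UNIV"
    and "\<not> finite_cdim (orth_compl (dom S))"
    and "regular_operator S"
    and "S\<^sub>0' = projected_operator S \<or>
         closed_symmetric_extension_in (dom_closure S) (projected_operator S) S\<^sub>0'"
  shows "\<exists>T. selfadjoint_operator T \<and> S \<subseteq>\<^sub>m T \<and> compression (dom_closure S) T = S\<^sub>0'"
proof -
  let ?M = "dom_closure S" and ?S0 = "projected_operator S" and ?P = "orth_proj (dom_closure S)"
  let ?B = "S\<^sub>0'"
  have lin: "linear_operator S" using assms(3) by (simp add: symmetric_operator_def)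
  note M = closed_csubspace_dom_closure[OF lin]
  have ext0: "closed_symmetric_extension_in ?M ?S0 ?S0"
    by (rule projected_operator_extends_itself) fact+
  then have lin0: "linear_operator ?S0"
    by (simp add: closed_symmetric_extension_in_def symmetric_operator_def)
  have "closed_symmetric_extension_in ?M ?S0 ?B" using assms(8) ext0 by blast
  then have B: "symmetric_operator ?B" "closed_operator ?B" "dom ?B \<subseteq> ?M" "ran ?B \<subseteq> ?M" "?S0 \<subseteq>\<^sub>m ?B"
    by (simp_all add: closed_symmetric_extension_in_def)
  define R where "R = Map.graph ?B"
  have mem_R: "(g, b) \<in> R \<longleftrightarrow> ?B g = Some b" for g b by (simp add: R_def mem_graph_iff)
  have R: "closed R" "csubspace R" "R \<subseteq> ?M \<times> ?M" "R \<subseteq> adjoint_rel R"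
  proof -
    show "closed R" using B(2) by (simp add: R_def closed_operator_def)
    show "csubspace R" using B(1) csubspace_graph[of ?B] by (simp add: R_def symmetric_operator_def)
    show "R \<subseteq> ?M \<times> ?M" using subsetD[OF B(3) domI] subsetD[OF B(4) ranI] by (auto simp: mem_R)
    show "R \<subseteq> adjoint_rel R" unfolding R_def by (rule symmetric_operator_graph[OF B(1)])
  qed
  have dense: "x = 0" if "x \<in> ?M" "x \<in> orth_compl (fst ` R)" for x
  proof -
    have "dom S \<subseteq> fst ` R"
    proof
      fix f assume "f \<in> dom S"
      then obtain s where "S f = Some s" by blast
      then have "?B f = Some (?P s)"
        using B(5) projected_operator_Some by (metis domI map_le_def)
      then have "(f, ?P s) \<in> R" by (simp add: mem_R)
      then show "f \<in> fst ` R" by (metis fst_conv imageI)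
    qed
    then have "x \<in> orth_compl (dom S)" using that(2) by (auto simp: orth_compl_def)
    then have "x \<in> orth_compl ?M" by (simp add: dom_closure_def orth_compl_closure)
    then show ?thesis using that(1) orth_compl_Int by blast
  qed
  have "\<not> finite_cdim (orth_compl ?M)"
    using assms(6) by (simp add: dom_closure_def orth_compl_closure)
  from isometric_graph_exists[OF M closed_orth_compl csubspace_orth_compl assms(2) this]
  obtain V :: "('h \<times> 'h) set" where V: "csubspace V" "fst ` V = ?M" "snd ` V \<subseteq> orth_compl ?M"
    "closed (snd ` V)"
    and isom: "\<And>p q. p \<in> V \<Longrightarrow> q \<in> V \<Longrightarrow> cinner (snd p) (snd q) = cinner (fst p) (fst q)"
    by blast
  define Q where "Q = coupled_rel ?M R V"
  have Q: "adjoint_rel Q = Q"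
    unfolding Q_def by (rule coupled_rel_selfadjoint[OF M R V isom])
  \<comment> \<open>The part of \<open>Q\<close> with first component in \<open>?M\<close> is
    exactly the graph of \<open>?B\<close>.\<close>
  have Q_iff: "(g, t) \<in> Q \<longleftrightarrow> ?B g = Some t" if "g \<in> ?M" for g t
    unfolding mem_R[symmetric] Q_def
    using coupled_rel_restrict[OF M R V isom dense] subset_coupled_rel[OF M R V isom] that by blast
  obtain c :: "'h \<times> 'h \<Rightarrow> 'h" where c: "bounded_linear c" "\<And>a p. c (a *\<^sub>C p) = a *\<^sub>C c p"
    "\<And>p. c p \<in> orth_compl ?M" "\<And>p. p \<in> orth_compl ?M \<times> orth_compl ?M \<Longrightarrow> c p = 0"
    and Sc: "\<And>f s. S f = Some s \<Longrightarrow> s = ?P s + c (f, ?P s)"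
    using regular_operator_component[OF lin assms(4,7) lin0] by blast
  interpret c: bounded_linear c by (rule c(1))
  obtain c' where c': "\<And>p y. cinner (c p) y = cinner p (c' y)"
    using bounded_adjoint_exists[OF c(1,2)] by blast
  define C1 where "C1 x = c (x, 0)" for x
  define C2 where "C2 x = c (0, x)" for x
  define C1' where "C1' y = fst (c' y)" for y
  define C2' where "C2' y = snd (c' y)" for y
  have C1: "cinner (C1 x) y = cinner x (C1' y)" and C2: "cinner (C2 x) y = cinner x (C2' y)" for x y
    by (simp_all add: C1_def C1'_def C2_def C2'_def c' cinner_prod_def)
  have C1_flip: "cinner (C1' x) y = cinner x (C1 y)" for x y
    using C1[of y x] cinner_commute by metis
  have C2_add: "C2 (x + y) = C2 x + C2 y" and C2_diff: "C2 (x - y) = C2 x - C2 y" for x y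
    using c.add[of "(0, x)" "(0, y)"] c.diff[of "(0, x)" "(0, y)"] by (simp_all add: C2_def)
  \<comment> \<open>The values of \<open>c\<close> lie in the complement of \<open>?M\<close>, where
    \<open>C2\<close> vanishes. Thus \<open>x - C2 x\<close> inverts
    \<open>x + C2 x\<close>.\<close>
  have C2_C2: "C2 (C2 x) = 0" for x
    unfolding C2_def using c(3) by (intro c(4)) (simp add: orth_compl_def)
  \<comment> \<open>The adjoints vanish on \<open>?M\<close> because the range of \<open>c\<close>
    is orthogonal to it.\<close>
  have adj_0: "C1' y = 0" "C2' y = 0" if "y \<in> ?M" for y
  proof -
    have "cinner (C1' y) (C1' y) = 0" "cinner (C2' y) (C2' y) = 0"
      using orth_complD'[OF c(3) that] by (simp_all flip: C1 C2 add: C1_def C2_def)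
    then show "C1' y = 0" "C2' y = 0" by simp_all
  qed
  have c_split: "C2 t + C1 g = c (g, t)" for g t
    using c.add[of "(0, t)" "(g, 0)"] by (simp add: C1_def C2_def)
  \<comment> \<open>This is the congruence of \<open>Q\<close> by identity plus \<open>C2\<close>,
    perturbed by the symmetric map \<open>C1 g + C1' g\<close>. On \<open>?M\<close> it reduces to
    \<open>b + c (g, b)\<close> with \<open>b\<close> the value of \<open>?B\<close> at
    \<open>g\<close>, the form that \<open>Sc\<close> gives for \<open>S\<close>.\<close>
  define G where "G = {(g, h). \<exists>t. (g + C2' g, t) \<in> Q \<and> h = (t + C2 t) + (C1 g + C1' g)}"
  have G: "adjoint_rel G = G"
    unfolding G_def
    by (rule selfadjoint_rel_congruence[OF Q, where C = "\<lambda>x. x - C2 x" and C' = "\<lambda>x. x - C2' x"])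
      (simp_all add: cinner_add_left cinner_add_right cinner_diff_left cinner_diff_right
        C1 C2 C1_flip C2_add C2_diff C2_C2)
  have G_iff: "(g, h) \<in> G \<longleftrightarrow> (\<exists>b. ?B g = Some b \<and> h = b + c (g, b))" if "g \<in> ?M" for g h
    using that c_split by (auto simp: G_def adj_0 Q_iff add.assoc)
  have "h = 0" if "(0, h) \<in> G" for h
  proof -
    have "0 \<in> ?M" using M(2) complex_vector.subspace_0 by blast
    with that obtain b where b: "?B 0 = Some b" "h = b + c (0, b)" using G_iff by blast
    moreover have "?B 0 = Some 0"
      using complex_vector.subspace_0[OF R(2)] unfolding zero_prod_def mem_R .
    ultimately show "h = 0" using c.zero by (simp add: zero_prod_def)
  qed
  from selfadjoint_rel_operator[OF G this]
  obtain T where T: "Map.graph T = G" "selfadjoint_operator T" by blast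
  have T_iff: "T g = Some h \<longleftrightarrow> (\<exists>b. ?B g = Some b \<and> h = b + c (g, b))" if "g \<in> ?M" for g h
    using G_iff[OF that] by (simp add: mem_graph_iff flip: T(1))
  have "S \<subseteq>\<^sub>m T"
    unfolding map_le_def
  proof
    fix f assume f: "f \<in> dom S"
    then obtain s where s: "S f = Some s" by blast
    have "f \<in> ?M" using subsetD[OF closure_subset f] by (simp add: dom_closure_def)
    moreover have "?B f = Some (?P s)"
      using B(5) projected_operator_Some[of S, OF s] by (metis domI map_le_def)
    ultimately have "T f = Some s" using Sc[OF s] T_iff by blast
    with s show "S f = T f" by simp
  qed
  moreover have "compression ?M T = ?B"
  proof
    fix g
    show "compression ?M T g = ?B g"
    proof (cases "g \<in> ?M")
      case False
      then have "g \<notin> dom ?B" using B(3) by blast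
      then show ?thesis using False by (simp add: compression_def domIff)
    next
      case True
      show ?thesis
      proof (cases "?B g")
        case None
        then have "T g = None" using T_iff[OF True] by (metis not_Some_eq)
        then show ?thesis using True None by (simp add: compression_def)
      next
        case (Some b)
        then have "T g = Some (b + c (g, b))" using T_iff[OF True] by blast
        moreover have "b \<in> ?M" using subsetD[OF B(4) ranI[of ?B, OF Some]] .
        \<comment> \<open>The correction \<open>c (g, b)\<close> is orthogonal to \<open>?M\<close>,
          so compressing removes it.\<close>
        then have "?P (b + c (g, b)) = b" by (intro orth_proj_unique M) (simp_all add: c(3))
        ultimately show ?thesis using True Some by (simp add: compression_def)
      qed
    qed
  qed
  ultimately show ?thesis using T(2) by blast
qed

end
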